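(* Let $\mu$ be a finite positive measure on the unit circle $\mathbb S^1$, singular with respect to Lebesgue measure, such that $S_\mu'\in\mathcal N$. Then $\mu$ is supported on (i.e. gives full mass to) a countable union of Beurling-Carleson sets.
   Context: $S_\mu(z)=\exp\bigl(-\int_{\mathbb S^1}\frac{\zeta+z}{\zeta-z}\,d\mu(\zeta)\bigr)$, $z\in\mathbb D$ (the unit disk), is the singular inner function associated to $\mu$. The Nevanlinna class $\mathcal N$ consists of holomorphic $f$ on $\mathbb D$ with $\sup_{0<r<1}\frac1{2\pi}\int_0^{2\pi}\log^+|f(re^{i\theta})|\,d\theta<\infty$. A Beurling-Carleson set is a closed subset of $\mathbb S^1$ of zero Lebesgue measure whose complement is a disjoint union of open arcs $\bigcup_k I_k$ with $\sum_k|I_k|\log\frac1{|I_k|}<\infty$. *)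

theory Defs
  imports "HOL-Complex_Analysis.Complex_Analysis"
begin

abbreviation unit_circle :: "complex set" where
  "unit_circle \<equiv> sphere 0 1"

abbreviation circle_borel :: "complex measure" where
  "circle_borel \<equiv> restrict_space borel unit_circle"

(* Lebesgue (arc length) measure on the circle, of total mass 2 * pi. *)
definition circle_lebesgue :: "complex measure" where
  "circle_lebesgue = distr (restrict_space lborel {0..<2 * pi}) circle_borel cis"

lemma cis_measurable_circle [measurable]:
  "cis \<in> restrict_space lborel {0..<2 * pi} \<rightarrow>\<^sub>M circle_borel"
proof -
  have "continuous_on UNIV cis"
    unfolding cis_conv_exp [abs_def] by (intro continuous_intros)
  then have "cis \<in> borel_measurable lborel"
    by (simp add: borel_measurable_continuous_onI)
  then show ?thesis
    by (intro measurable_restrict_space2 measurable_restrict_space1) auto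
qed

definition mutually_singular :: "'a measure \<Rightarrow> 'a measure \<Rightarrow> bool" where
  "mutually_singular M N \<longleftrightarrow>
     sets M = sets N \<and> (\<exists>A \<in> null_sets N. space M - A \<in> null_sets M)"

definition singular_inner :: "complex measure \<Rightarrow> complex \<Rightarrow> complex" where
  "singular_inner \<mu> z = exp (- (\<integral>\<zeta>. (\<zeta> + z) / (\<zeta> - z) \<partial>\<mu>))"

(* Since ln 0 = 0, the value at x = 0 is the intended one, namely 0. *)
definition log_plus :: "real \<Rightarrow> real" where
  "log_plus x = max 0 (ln x)"

definition nevanlinna_class :: "(complex \<Rightarrow> complex) set" where
  "nevanlinna_class = {f. f holomorphic_on ball 0 1 \<and>
     bdd_above ((\<lambda>r. 1 / (2 * pi) *
       integral {0..2 * pi} (\<lambda>\<theta>. log_plus (norm (f (of_real r * cis \<theta>))))) ` {0<..<1})}"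

(* The bound b \<le> a + 2 * pi makes cis injective on the parameter interval; equality
   gives the circle with one point removed. *)
definition open_arc :: "complex set \<Rightarrow> bool" where
  "open_arc I \<longleftrightarrow> (\<exists>a b. a < b \<and> b \<le> a + 2 * pi \<and> I = cis ` {a<..<b})"

definition arc_length :: "complex set \<Rightarrow> real" where
  "arc_length I = measure circle_lebesgue I"

(* At most six of the disjoint arcs are longer than 1, so only finitely many of the terms
   of the entropy sum are negative and summability means that the sum is less than
   infinity. *)
definition beurling_carleson :: "complex set \<Rightarrow> bool" where
  "beurling_carleson E \<longleftrightarrow>
     closed E \<and> E \<subseteq> unit_circle \<and> E \<in> null_sets circle_lebesgue \<and>
     (\<exists>\<I>. (\<forall>I \<in> \<I>. open_arc I) \<and> disjoint \<I> \<and> unit_circle - E = \<Union>\<I> \<and>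
        (\<lambda>I. arc_length I * ln (1 / arc_length I)) summable_on \<I>)"

end

theory Submission
  imports Defs "HOL-Real_Asymp.Real_Asymp"
begin

text \<open>
  Let S be the singular inner function of \<mu>, let P be the Poisson integral of \<mu>, and put
  D(\<xi>) = \<integral> |\<zeta> - \<xi>|^(-2) d\<mu>(\<zeta>) for \<xi> on the circle. Then |S| = exp(-P), and at each point \<xi>
  where D is finite and which is no atom of \<mu> the radial limit of |S'| is 2 D(\<xi>).

  The analytic half of the proof shows that log^+(2 D) is integrable over the circle. Once D is known
  to be finite almost everywhere, this is Fatou's lemma for the integral means of log^+ |S'|.
  Finiteness of D comes from two facts that hold on almost every radius. Since S' is in the
  Nevanlinna class, log^+ |S'| is dominated on smaller discs by Poisson integrals of measures of
  bounded mass, and the weak type inequality for the radial maximal function of such integrals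
  (weak_type_radial_maximal) shows that S' is bounded on almost every radius
  (nevanlinna_class_radially_bounded). Since \<mu> is singular, P comes arbitrarily close to 0 along almost
  every radius (singular_poisson_radially_small). On a radius with both properties |S| comes
  arbitrarily close to 1 and S is Lipschitz, so that 1 - |S(r \<xi>)| = O(1 - r). Hence
  P(r \<xi>) = O(1 - r), and this says that D(\<xi>) is finite.

  The combinatorial half uses dyadic arcs. An arc of generation n, of length 2 \<pi> / 2^n, is called
  light if its mass is at most 3^(-n). Let E_k be the circle without the interiors of the maximal
  light arcs of generation at least k; these interiors are the complementary arcs of E_k. The rate 1/3
  is chosen strictly between 1/4 and 1/2. Because 1/3 < 1/2, the union of the light arcs of generation
  at least k has mass at most (2/3)^k, so the sets E_k together carry \<mu>. Because 1/3 > 1/4, on an arc of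
  generation n that is not light D is at least a constant times (4/3)^n. The parent of a maximal
  light arc of generation n > k is not light, so n is at most a constant times 1 + log^+(2 D) at almost
  every point of the arc, and the entropy sum over the complementary arcs is bounded by the integral of
  1 + log^+(2 D). Finally, apart from dyadic endpoints, a point of E_k lies in arcs of every
  generation n \<ge> k that are not light, so D is infinite there, and E_k is a null set.
\<close>

section \<open>The Herglotz transform of a measure on the circle\<close>

locale circle_measure = finite_measure \<mu> for \<mu> :: "complex measure" +
  assumes sets_circle: "sets \<mu> = sets circle_borel"
begin

lemma space_circle: "space \<mu> = unit_circle"
  using sets_eq_imp_space_eq[OF sets_circle] by (simp add: space_restrict_space)

lemma borel_measurable_circle:
  "f \<in> borel_measurable borel \<Longrightarrow> f \<in> borel_measurable \<mu>"
  by (subst measurable_cong_sets[OF sets_circle refl]) (rule measurable_restrict_space1)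

lemma integrable_circle_bounded:
  fixes f :: "complex \<Rightarrow> 'b::{banach, second_countable_topology}"
  assumes "f \<in> borel_measurable borel" and "\<And>\<zeta>. norm \<zeta> = 1 \<Longrightarrow> norm (f \<zeta>) \<le> B"
  shows "integrable \<mu> f"
proof (rule integrable_const_bound)
  show "AE \<zeta> in \<mu>. norm (f \<zeta>) \<le> B"
    by (rule AE_I2) (simp add: space_circle assms(2))
  show "f \<in> borel_measurable \<mu>"
    by (rule borel_measurable_circle[OF assms(1)])
qed

end

lemma dist_circle_lower:
  fixes \<zeta> z :: complex
  assumes "norm \<zeta> = 1" shows "1 - norm z \<le> norm (\<zeta> - z)"
  using norm_triangle_ineq2[of \<zeta> z] assms by simp

definition poisson_kernel :: "complex \<Rightarrow> complex \<Rightarrow> real" where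
  "poisson_kernel z \<zeta> = (1 - (norm z)\<^sup>2) / (norm (\<zeta> - z))\<^sup>2"

lemma Re_herglotz_kernel:
  assumes "norm \<zeta> = 1"
  shows "Re ((\<zeta> + z) / (\<zeta> - z)) = poisson_kernel z \<zeta>"
proof -
  have "(\<zeta> + z) / (\<zeta> - z) = (\<zeta> + z) * cnj (\<zeta> - z) / of_real ((norm (\<zeta> - z))\<^sup>2)"
    by (rule complex_div_cnj)
  moreover have "Re ((\<zeta> + z) * cnj (\<zeta> - z)) = 1 - (norm z)\<^sup>2"
  proof -
    have "Re ((\<zeta> + z) * cnj (\<zeta> - z)) = (norm \<zeta>)\<^sup>2 - (norm z)\<^sup>2"
      unfolding cmod_power2 by (simp add: algebra_simps power2_eq_square)
    then show ?thesis using assms by simp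
  qed
  ultimately show ?thesis
    by (simp add: poisson_kernel_def flip: of_real_power)
qed

lemma poisson_kernel_nonneg: "norm z \<le> 1 \<Longrightarrow> 0 \<le> poisson_kernel z \<zeta>"
  by (auto simp: poisson_kernel_def abs_square_le_1 intro!: divide_nonneg_nonneg)

lemma poisson_kernel_le_far:
  assumes "norm z < 1" "0 < d" "d \<le> norm (\<zeta> - z)"
  shows "poisson_kernel z \<zeta> \<le> (1 - (norm z)\<^sup>2) / d\<^sup>2"
  unfolding poisson_kernel_def using assms
  by (intro divide_left_mono power_mono mult_pos_pos) (auto simp: abs_square_le_1)

lemma poisson_kernel_le:
  assumes "norm z < 1" "norm \<zeta> = 1"
  shows "poisson_kernel z \<zeta> \<le> 2 / (1 - norm z)"
proof -
  have "poisson_kernel z \<zeta> \<le> (1 - (norm z)\<^sup>2) / (1 - norm z)\<^sup>2"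
    using assms by (intro poisson_kernel_le_far dist_circle_lower) auto
  also have "\<dots> = (1 + norm z) / (1 - norm z)"
    using assms by (simp add: divide_simps power2_eq_square) (simp add: algebra_simps)
  also have "\<dots> \<le> 2 / (1 - norm z)"
    using assms by (intro divide_right_mono) auto
  finally show ?thesis .
qed

lemma poisson_kernel_measurable [measurable]: "poisson_kernel z \<in> borel_measurable borel"
  unfolding poisson_kernel_def [abs_def] by measurable

definition herglotz :: "complex measure \<Rightarrow> complex \<Rightarrow> complex" where
  "herglotz \<mu> z = (\<integral>\<zeta>. (\<zeta> + z) / (\<zeta> - z) \<partial>\<mu>)"

definition poisson :: "complex measure \<Rightarrow> complex \<Rightarrow> real" where
  "poisson \<mu> z = (\<integral>\<zeta>. poisson_kernel z \<zeta> \<partial>\<mu>)"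

context circle_measure
begin

lemma integrable_herglotz:
  assumes "norm z < 1"
  shows "integrable \<mu> (\<lambda>\<zeta>. (\<zeta> + z) / (\<zeta> - z))"
proof (rule integrable_circle_bounded)
  fix \<zeta> :: complex assume \<zeta>: "norm \<zeta> = 1"
  have "norm ((\<zeta> + z) / (\<zeta> - z)) = norm (\<zeta> + z) / norm (\<zeta> - z)"
    by (rule norm_divide)
  also have "\<dots> \<le> 2 / (1 - norm z)"
    using assms \<zeta> norm_triangle_ineq[of \<zeta> z] dist_circle_lower[OF \<zeta>, of z]
    by (intro frac_le) auto
  finally show "norm ((\<zeta> + z) / (\<zeta> - z)) \<le> 2 / (1 - norm z)" .
qed measurable

lemma integrable_poisson_kernel:
  assumes "norm z < 1" shows "integrable \<mu> (poisson_kernel z)"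
  using assms
  by (intro integrable_circle_bounded[where B="2 / (1 - norm z)"])
     (auto simp: poisson_kernel_nonneg poisson_kernel_le)

lemma Re_herglotz:
  assumes "norm z < 1" shows "Re (herglotz \<mu> z) = poisson \<mu> z"
proof -
  have "Re (herglotz \<mu> z) = (\<integral>\<zeta>. Re ((\<zeta> + z) / (\<zeta> - z)) \<partial>\<mu>)"
    unfolding herglotz_def using integrable_herglotz[OF assms] by simp
  also have "\<dots> = poisson \<mu> z"
    unfolding poisson_def
    by (rule Bochner_Integration.integral_cong) (auto simp: space_circle Re_herglotz_kernel)
  finally show ?thesis .
qed

lemma poisson_nonneg: "norm z \<le> 1 \<Longrightarrow> 0 \<le> poisson \<mu> z"
  unfolding poisson_def by (intro integral_nonneg_AE AE_I2 poisson_kernel_nonneg)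

lemma integrable_herglotz_deriv:
  assumes "norm z < 1"
  shows "integrable \<mu> (\<lambda>\<zeta>. 2 * \<zeta> / (\<zeta> - z)\<^sup>2)"
proof (rule integrable_circle_bounded)
  fix \<zeta> :: complex assume \<zeta>: "norm \<zeta> = 1"
  have "(1 - norm z)\<^sup>2 \<le> (norm (\<zeta> - z))\<^sup>2"
    using assms dist_circle_lower[OF \<zeta>, of z] by (intro power_mono) auto
  then show "norm (2 * \<zeta> / (\<zeta> - z)\<^sup>2) \<le> 2 / (1 - norm z)\<^sup>2"
    using assms \<zeta> by (auto simp: norm_divide norm_mult norm_power intro!: frac_le)
qed measurable

text \<open>
  Differentiation under the integral sign is elementary here: the difference of two values of the
  kernel is an explicit fraction, so the error of the difference quotient is O(|w - z|) uniformly in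
  \<zeta>.
\<close>
lemma herglotz_has_field_derivative:
  assumes z: "norm z < 1"
  shows "(herglotz \<mu> has_field_derivative (\<integral>\<zeta>. 2 * \<zeta> / (\<zeta> - z)\<^sup>2 \<partial>\<mu>)) (at z)"
proof -
  define d where "d = (1 - norm z) / 2"
  have d: "d > 0" using z by (simp add: d_def)
  define D where "D = (\<integral>\<zeta>. 2 * \<zeta> / (\<zeta> - z)\<^sup>2 \<partial>\<mu>)"
  define C where "C = 2 / (d * (2 * d)\<^sup>2) * measure \<mu> (space \<mu>)"
  have bound: "norm ((herglotz \<mu> w - herglotz \<mu> z) / (w - z) - D) \<le> norm (w - z) * C"
    if w: "dist w z < d" "w \<noteq> z" for w
  proof -
    have nw: "norm w < 1 - d"
      using w(1) norm_triangle_ineq2[of w z] unfolding dist_norm d_def by (simp add: field_simps)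
    then have nw1: "norm w < 1" using d by simp
    have "(herglotz \<mu> w - herglotz \<mu> z) / (w - z)
        = (\<integral>\<zeta>. ((\<zeta> + w) / (\<zeta> - w) - (\<zeta> + z) / (\<zeta> - z)) / (w - z) \<partial>\<mu>)"
      unfolding herglotz_def using integrable_herglotz[OF nw1] integrable_herglotz[OF z] by simp
    then have "(herglotz \<mu> w - herglotz \<mu> z) / (w - z) - D
        = (\<integral>\<zeta>. ((\<zeta> + w) / (\<zeta> - w) - (\<zeta> + z) / (\<zeta> - z)) / (w - z) - 2 * \<zeta> / (\<zeta> - z)\<^sup>2 \<partial>\<mu>)"
      unfolding D_def using integrable_herglotz[OF nw1] integrable_herglotz[OF z]
        integrable_herglotz_deriv[OF z] by simp
    also have "norm \<dots> \<le> (\<integral>\<zeta>. norm (w - z) * (2 / (d * (2 * d)\<^sup>2)) \<partial>\<mu>)"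
    proof (rule Bochner_Integration.integral_norm_bound_integral)
      show "integrable \<mu> (\<lambda>\<zeta>. ((\<zeta> + w) / (\<zeta> - w) - (\<zeta> + z) / (\<zeta> - z)) / (w - z) - 2 * \<zeta> / (\<zeta> - z)\<^sup>2)"
        using integrable_herglotz[OF nw1] integrable_herglotz[OF z]
        integrable_herglotz_deriv[OF z] by simp
      fix \<zeta> assume "\<zeta> \<in> space \<mu>"
      then have \<zeta>: "norm \<zeta> = 1" by (simp add: space_circle)
      have 1: "d \<le> norm (\<zeta> - w)" using dist_circle_lower[OF \<zeta>, of w] nw by simp
      have 2: "2 * d \<le> norm (\<zeta> - z)" using dist_circle_lower[OF \<zeta>, of z] by (simp add: d_def)
      have ne: "\<zeta> - w \<noteq> 0" "\<zeta> - z \<noteq> 0" "w - z \<noteq> 0"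
        using 1 2 d w(2) by auto
      have "((\<zeta> + w) / (\<zeta> - w) - (\<zeta> + z) / (\<zeta> - z)) / (w - z) - 2 * \<zeta> / (\<zeta> - z)\<^sup>2
          = 2 * \<zeta> * (w - z) / ((\<zeta> - w) * (\<zeta> - z)\<^sup>2)"
      proof -
        have "(\<zeta> + w) / (\<zeta> - w) - (\<zeta> + z) / (\<zeta> - z) = (w - z) * (2 * \<zeta>) / ((\<zeta> - w) * (\<zeta> - z))"
          using ne by (simp add: divide_simps) (simp add: algebra_simps)
        then have "((\<zeta> + w) / (\<zeta> - w) - (\<zeta> + z) / (\<zeta> - z)) / (w - z) = 2 * \<zeta> / ((\<zeta> - w) * (\<zeta> - z))"
          using ne by simp
        then show ?thesis
          using ne by (simp add: divide_simps power2_eq_square) (simp add: algebra_simps)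
      qed
      also have "norm \<dots> = norm (w - z) * (2 / (norm (\<zeta> - w) * (norm (\<zeta> - z))\<^sup>2))"
        using \<zeta> by (simp add: norm_divide norm_mult norm_power)
      also have "\<dots> \<le> norm (w - z) * (2 / (d * (2 * d)\<^sup>2))"
        using 1 2 d by (intro mult_left_mono divide_left_mono mult_mono power_mono mult_pos_pos) auto
      finally show "norm (((\<zeta> + w) / (\<zeta> - w) - (\<zeta> + z) / (\<zeta> - z)) / (w - z) - 2 * \<zeta> / (\<zeta> - z)\<^sup>2)
         \<le> norm (w - z) * (2 / (d * (2 * d)\<^sup>2))" .
    qed simp
    also have "\<dots> = norm (w - z) * C"
      by (simp add: C_def)
    finally show ?thesis .
  qed
  have "((\<lambda>w. (herglotz \<mu> w - herglotz \<mu> z) / (w - z) - D) \<longlongrightarrow> 0) (at z)"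
  proof (rule Lim_null_comparison)
    show "\<forall>\<^sub>F w in at z. norm ((herglotz \<mu> w - herglotz \<mu> z) / (w - z) - D) \<le> norm (w - z) * C"
      unfolding eventually_at using d bound by blast
    show "((\<lambda>w. norm (w - z) * C) \<longlongrightarrow> 0) (at z)"
      by (rule tendsto_eq_intros refl | simp)+
  qed
  then show ?thesis
    unfolding D_def[symmetric] has_field_derivative_iff using Lim_null by blast
qed

lemma herglotz_holomorphic: "herglotz \<mu> holomorphic_on ball 0 1"
  unfolding holomorphic_on_def
  using herglotz_has_field_derivative has_field_derivative_at_within
  by (fastforce simp: field_differentiable_def)

lemma singular_inner_eq: "singular_inner \<mu> z = exp (- herglotz \<mu> z)"
  by (simp add: singular_inner_def herglotz_def)

lemma norm_singular_inner: "norm z < 1 \<Longrightarrow> norm (singular_inner \<mu> z) = exp (- poisson \<mu> z)"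
  by (simp add: singular_inner_eq Re_herglotz)

lemma singular_inner_has_field_derivative:
  assumes z: "norm z < 1"
  shows "(singular_inner \<mu> has_field_derivative
     - (\<integral>\<zeta>. 2 * \<zeta> / (\<zeta> - z)\<^sup>2 \<partial>\<mu>) * singular_inner \<mu> z) (at z)"
  unfolding singular_inner_eq[abs_def]
  by (rule derivative_eq_intros herglotz_has_field_derivative[OF z] refl | simp)+

end

section \<open>Arc length and Poisson integrals of continuous densities\<close>

lemma log_plus_nonneg: "0 \<le> log_plus x"
  by (simp add: log_plus_def)

lemma le_exp_log_plus: "0 \<le> x \<Longrightarrow> x \<le> exp (log_plus x)"
  by (cases "x = 0") (auto simp: log_plus_def max_def ln_ge_iff)

lemma log_plus_le_iff: "0 \<le> x \<Longrightarrow> 0 \<le> c \<Longrightarrow> log_plus x \<le> c \<longleftrightarrow> x \<le> exp c"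
  using exp_le_cancel_iff[of "ln x" c] by (cases "x = 0") (auto simp: log_plus_def)

lemma log_plus_eq_ln_max: "0 \<le> x \<Longrightarrow> log_plus x = ln (max 1 x)"
  by (cases "x = 0") (auto simp: log_plus_def max_def)

lemma log_plus_mono: "0 \<le> x \<Longrightarrow> x \<le> y \<Longrightarrow> log_plus x \<le> log_plus y"
  by (auto simp: log_plus_eq_ln_max)

lemma continuous_on_log_plus_norm [continuous_intros]:
  fixes f :: "'a::topological_space \<Rightarrow> 'b::real_normed_vector"
  assumes "continuous_on S f"
  shows "continuous_on S (\<lambda>x. log_plus (norm (f x)))"
  unfolding log_plus_eq_ln_max[OF norm_ge_zero]
  using assms by (intro continuous_intros) auto

lemma sets_circle_lebesgue: "sets circle_lebesgue = sets circle_borel"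
  by (simp add: circle_lebesgue_def)

lemma borel_measurable_circle_lebesgue:
  "continuous_on unit_circle g \<Longrightarrow> g \<in> borel_measurable circle_lebesgue"
  by (subst measurable_cong_sets[OF sets_circle_lebesgue refl])
     (rule borel_measurable_continuous_on_restrict)

lemma nn_integral_circle_lebesgue:
  assumes "f \<in> borel_measurable circle_borel"
  shows "(\<integral>\<^sup>+\<zeta>. f \<zeta> \<partial>circle_lebesgue) = (\<integral>\<^sup>+\<theta>\<in>{0..<2*pi}. f (cis \<theta>) \<partial>lborel)"
  unfolding circle_lebesgue_def using assms
  by (simp add: nn_integral_distr nn_integral_restrict_space)

lemma emeasure_circle_lebesgue_space: "emeasure circle_lebesgue (space circle_lebesgue) = ennreal (2 * pi)"
proof -
  have "emeasure circle_lebesgue (space circle_lebesgue) = (\<integral>\<^sup>+\<zeta>. 1 \<partial>circle_lebesgue)"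
    by simp
  also have "\<dots> = ennreal (2 * pi)"
    by (subst nn_integral_circle_lebesgue) simp_all
  finally show ?thesis .
qed

interpretation circle_lebesgue: circle_measure circle_lebesgue
  by (intro circle_measure.intro finite_measureI circle_measure_axioms.intro)
     (simp_all add: emeasure_circle_lebesgue_space sets_circle_lebesgue)

lemma
  fixes g :: "complex \<Rightarrow> real"
  assumes g: "continuous_on unit_circle g"
  shows integrable_circle_lebesgue: "integrable circle_lebesgue g"
    and integral_circle_lebesgue:
      "(\<integral>\<zeta>. g \<zeta> \<partial>circle_lebesgue) = integral {0..2*pi} (\<lambda>\<theta>. g (cis \<theta>))"
proof -
  have gc: "continuous_on {0..2*pi} (\<lambda>\<theta>. g (cis \<theta>))"
    by (rule continuous_on_compose2[OF g]) (auto intro!: continuous_intros simp: cis_conv_exp)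
  have si: "set_integrable lborel {0..2*pi} (\<lambda>\<theta>. g (cis \<theta>))"
    by (rule borel_integrable_atLeastAtMost'[OF gc])
  then have si': "set_integrable lborel {0..<2*pi} (\<lambda>\<theta>. g (cis \<theta>))"
    by (rule set_integrable_subset) auto
  have gm: "g \<in> borel_measurable circle_borel"
    by (rule borel_measurable_continuous_on_restrict[OF g])
  show "integrable circle_lebesgue g"
    unfolding circle_lebesgue_def using si' gm
    by (subst integrable_distr_eq) (auto simp: integrable_restrict_space set_integrable_def)
  have "(\<integral>\<zeta>. g \<zeta> \<partial>circle_lebesgue) = (LINT \<theta>:{0..<2*pi}|lborel. g (cis \<theta>))"
    unfolding circle_lebesgue_def using gm
    by (subst integral_distr) (auto simp: integral_restrict_space set_lebesgue_integral_def)
  also have "\<dots> = (LINT \<theta>:{0..2*pi}|lborel. g (cis \<theta>))"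
    unfolding set_lebesgue_integral_def
  proof (rule integral_cong_AE)
    show "(\<lambda>\<theta>. indicator {0..<2*pi} \<theta> *\<^sub>R g (cis \<theta>)) \<in> borel_measurable lborel"
      using si' unfolding set_integrable_def by (rule borel_measurable_integrable)
    show "(\<lambda>\<theta>. indicator {0..2*pi} \<theta> *\<^sub>R g (cis \<theta>)) \<in> borel_measurable lborel"
      using si unfolding set_integrable_def by (rule borel_measurable_integrable)
    show "AE \<theta> in lborel. indicator {0..<2*pi} \<theta> *\<^sub>R g (cis \<theta>) = indicator {0..2*pi} \<theta> *\<^sub>R g (cis \<theta>)"
      using AE_lborel_singleton[of "2*pi"] by eventually_elim (auto simp: indicator_def)
  qed
  also have "\<dots> = integral {0..2*pi} (\<lambda>\<theta>. g (cis \<theta>))"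
    by (rule set_borel_integral_eq_integral(2)[OF si])
  finally show "(\<integral>\<zeta>. g \<zeta> \<partial>circle_lebesgue) = integral {0..2*pi} (\<lambda>\<theta>. g (cis \<theta>))" .
qed

lemma continuous_on_poisson_kernel:
  "norm z < 1 \<Longrightarrow> continuous_on unit_circle (poisson_kernel z)"
  unfolding poisson_kernel_def[abs_def] by (intro continuous_intros) auto

text \<open>
  The Poisson kernel is the real part of 2 \<zeta> / (\<zeta> - z) - 1, whose mean over the circle is 1 by Cauchy's
  integral formula for the constant function 1.
\<close>
lemma poisson_circle_lebesgue:
  assumes z: "norm z < 1"
  shows "poisson circle_lebesgue z = 2 * pi"
proof -
  have "((\<lambda>u. 1 / (u - z)) has_contour_integral (2 * of_real pi * \<i> * 1)) (circlepath 0 1)"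
    using z by (intro Cauchy_integral_circlepath_simple) auto
  then have "((\<lambda>t. 1 / (0 + of_real 1 * cis t - z) * of_real 1 * \<i> * cis t) has_integral (2 * of_real pi * \<i>)) {0..2*pi}"
    unfolding circlepath_def by (subst (asm) has_contour_integral_part_circlepath_iff) auto
  then have "((\<lambda>t. 2 * (- \<i> * (1 / (0 + of_real 1 * cis t - z) * of_real 1 * \<i> * cis t)) - 1) has_integral
      (2 * (- \<i> * (2 * of_real pi * \<i>)) - of_real (2 * pi))) {0..2*pi}"
    using has_integral_const_real[of "1::complex" 0 "2*pi"]
    by (intro has_integral_diff has_integral_mult_right) (auto simp: scaleR_conv_of_real)
  then have "((\<lambda>t. Re (2 * (- \<i> * (1 / (0 + of_real 1 * cis t - z) * of_real 1 * \<i> * cis t)) - 1)) has_integral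
      Re (2 * (- \<i> * (2 * of_real pi * \<i>)) - of_real (2 * pi))) {0..2*pi}"
    by (rule has_integral_Re)
  also have "Re (2 * (- \<i> * (2 * of_real pi * \<i>)) - of_real (2 * pi)) = 2 * pi"
    by simp
  finally have *: "((\<lambda>t. poisson_kernel z (cis t)) has_integral 2 * pi) {0..2*pi}"
  proof (rule has_integral_eq[rotated])
    fix t :: real
    have ne: "cis t - z \<noteq> 0" using z by auto
    have "2 * (- \<i> * (1 / (0 + of_real 1 * cis t - z) * of_real 1 * \<i> * cis t)) - 1 = (cis t + z) / (cis t - z)"
      using ne by (simp add: field_simps)
    then show "Re (2 * (- \<i> * (1 / (0 + of_real 1 * cis t - z) * of_real 1 * \<i> * cis t)) - 1) = poisson_kernel z (cis t)"
      by (simp add: Re_herglotz_kernel)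
  qed
  show ?thesis
    unfolding poisson_def
    by (subst integral_circle_lebesgue[OF continuous_on_poisson_kernel[OF z]])
       (rule integral_unique[OF *])
qed

lemma
  assumes c: "continuous_on unit_circle G" and nn: "\<And>\<zeta>. 0 \<le> G \<zeta>"
  shows circle_measure_density: "circle_measure (density circle_lebesgue (\<lambda>\<zeta>. ennreal (G \<zeta>)))"
    and poisson_density: "poisson (density circle_lebesgue (\<lambda>\<zeta>. ennreal (G \<zeta>))) z
      = (\<integral>\<zeta>. G \<zeta> * poisson_kernel z \<zeta> \<partial>circle_lebesgue)"
proof -
  have m: "G \<in> borel_measurable circle_lebesgue"
    by (rule borel_measurable_circle_lebesgue[OF c])
  have "(\<integral>\<^sup>+\<zeta>. ennreal (G \<zeta>) \<partial>circle_lebesgue) \<noteq> \<infinity>"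
    using integrable_circle_lebesgue[OF c] nn by (simp add: nn_integral_eq_integral)
  moreover have "emeasure (density circle_lebesgue (\<lambda>\<zeta>. ennreal (G \<zeta>))) (space circle_lebesgue)
      = (\<integral>\<^sup>+\<zeta>. ennreal (G \<zeta>) \<partial>circle_lebesgue)"
    by (subst emeasure_density[OF measurable_compose[OF m measurable_ennreal] sets.top])
       (rule nn_integral_cong, simp)
  ultimately show "circle_measure (density circle_lebesgue (\<lambda>\<zeta>. ennreal (G \<zeta>)))"
    by (intro circle_measure.intro finite_measureI circle_measure_axioms.intro)
       (simp_all add: sets_circle_lebesgue)
  show "poisson (density circle_lebesgue (\<lambda>\<zeta>. ennreal (G \<zeta>))) z
      = (\<integral>\<zeta>. G \<zeta> * poisson_kernel z \<zeta> \<partial>circle_lebesgue)"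
    unfolding poisson_def using m nn
    by (subst integral_density)
       (auto intro!: circle_lebesgue.borel_measurable_circle poisson_kernel_measurable)
qed

text \<open>
  Let G = log^+ |F| and let U be the Herglotz transform of the density G. On a circle of radius r
  close to 1, Re U is at least 2 \<pi> G minus a small error, since the Poisson kernel has total mass 2 \<pi>,
  concentrates near the boundary, and G is uniformly continuous on the closed disc. Hence
  F exp(-U / (2 \<pi>)) has modulus at most 1 plus a small error on that circle, and the maximum modulus
  principle carries the bound inside.
\<close>
lemma log_plus_le_poisson:
  assumes holo: "F holomorphic_on ball 0 R" and R: "1 < R" and z: "norm z < 1"
  shows "2 * pi * log_plus (norm (F z)) \<le> (\<integral>\<zeta>. log_plus (norm (F \<zeta>)) * poisson_kernel z \<zeta> \<partial>circle_lebesgue)"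
proof -
  define G where "G \<zeta> = log_plus (norm (F \<zeta>))" for \<zeta>
  define \<nu> where "\<nu> = density circle_lebesgue (\<lambda>\<zeta>. ennreal (G \<zeta>))"
  have Fc: "continuous_on (ball 0 R) F"
    using holo by (rule holomorphic_on_imp_continuous_on)
  have Gc: "continuous_on (cball 0 1) G"
    unfolding G_def[abs_def] using R by (intro continuous_intros continuous_on_subset[OF Fc]) auto
  then have Gs: "continuous_on unit_circle G"
    by (rule continuous_on_subset) auto
  have Gnn: "0 \<le> G \<zeta>" for \<zeta> by (simp add: G_def log_plus_nonneg)
  interpret \<nu>: circle_measure \<nu>
    unfolding \<nu>_def using Gs Gnn by (rule circle_measure_density)
  have P: "poisson \<nu> w = (\<integral>\<zeta>. G \<zeta> * poisson_kernel w \<zeta> \<partial>circle_lebesgue)" for w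
    unfolding \<nu>_def using Gs Gnn by (rule poisson_density)
  have intGk: "integrable circle_lebesgue (\<lambda>\<zeta>. G \<zeta> * poisson_kernel w \<zeta>)" if "norm w < 1" for w
    using that by (intro integrable_circle_lebesgue continuous_intros Gs continuous_on_poisson_kernel)
  obtain B where B: "\<And>w. norm w \<le> 1 \<Longrightarrow> G w \<le> B"
  proof -
    have "compact (G ` cball 0 1)" by (intro compact_continuous_image Gc) auto
    then obtain B where "\<forall>x\<in>G ` cball 0 1. norm x \<le> B"
      using compact_imp_bounded bounded_iff by metis
    then have "G w \<le> B" if "norm w \<le> 1" for w
      using that by (auto simp: abs_le_iff)
    then show ?thesis using that[of B] by blast
  qed
  then have B0: "0 \<le> B" using order_trans[OF Gnn B[of 0]] by simp
  have unif: "uniformly_continuous_on (cball 0 1) G"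
    by (rule compact_uniformly_continuous[OF Gc]) auto
  have "2 * pi * G z \<le> poisson \<nu> z + e" if e: "e > 0" for e
  proof -
    define e' where "e' = e / (4 * pi)"
    have e': "e' > 0" using e by (simp add: e'_def)
    obtain d where d: "d > 0" "\<And>x y. norm x \<le> 1 \<Longrightarrow> norm y \<le> 1 \<Longrightarrow> dist x y < d \<Longrightarrow> dist (G x) (G y) < e'"
      using unif e' unfolding uniformly_continuous_on_def by fastforce
    have "((\<lambda>r. B * (1 - r\<^sup>2) / d\<^sup>2) \<longlongrightarrow> B * (1 - 1\<^sup>2) / d\<^sup>2) (at_left 1)"
      using d(1) by (intro tendsto_intros) auto
    then have "\<forall>\<^sub>F r in at_left 1. B * (1 - r\<^sup>2) / d\<^sup>2 < e'"
      by (rule order_tendstoD) (use e' in simp)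
    moreover have "\<forall>\<^sub>F r in at_left 1. norm z < r \<and> r < 1"
      using eventually_at_left_real[OF z] by eventually_elim auto
    ultimately have "\<forall>\<^sub>F r in at_left 1. B * (1 - r\<^sup>2) / d\<^sup>2 < e' \<and> norm z < r \<and> r < 1"
      by eventually_elim auto
    then obtain r where r: "B * (1 - r\<^sup>2) / d\<^sup>2 < e'" "norm z < r" "r < 1"
      using eventually_happens'[OF trivial_limit_at_left_real] by blast
    have r0: "0 < r" using r(2) norm_ge_zero[of z] by linarith
    \<comment> \<open>split the circle at distance d from w: near w use continuity of G, away from w the smallness of the kernel\<close>
    have low: "2 * pi * G w - e \<le> poisson \<nu> w" if w: "norm w = r" for w
    proof -
      have w1: "norm w < 1" using w r by simp
      have "(\<integral>\<zeta>. G w * poisson_kernel w \<zeta> - e' * poisson_kernel w \<zeta> - e' \<partial>circle_lebesgue)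
          \<le> (\<integral>\<zeta>. G \<zeta> * poisson_kernel w \<zeta> \<partial>circle_lebesgue)"
      proof (rule integral_mono)
        show "integrable circle_lebesgue (\<lambda>\<zeta>. G w * poisson_kernel w \<zeta> - e' * poisson_kernel w \<zeta> - e')"
          using circle_lebesgue.integrable_poisson_kernel[OF w1] by simp
        show "integrable circle_lebesgue (\<lambda>\<zeta>. G \<zeta> * poisson_kernel w \<zeta>)"
          by (rule intGk[OF w1])
        fix \<zeta> assume "\<zeta> \<in> space circle_lebesgue"
        then have \<zeta>: "norm \<zeta> = 1" by (simp add: circle_lebesgue.space_circle)
        have k0: "0 \<le> poisson_kernel w \<zeta>" using w1 by (simp add: poisson_kernel_nonneg)
        show "G w * poisson_kernel w \<zeta> - e' * poisson_kernel w \<zeta> - e' \<le> G \<zeta> * poisson_kernel w \<zeta>"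
        proof (cases "dist \<zeta> w < d")
          case True
          then have "G w - e' \<le> G \<zeta>" using d(2)[of \<zeta> w] \<zeta> w1 by (auto simp: dist_real_def)
          then have "(G w - e') * poisson_kernel w \<zeta> \<le> G \<zeta> * poisson_kernel w \<zeta>"
            using k0 by (rule mult_right_mono)
          then show ?thesis using e' by (simp add: algebra_simps)
        next
          case False
          then have "poisson_kernel w \<zeta> \<le> (1 - r\<^sup>2) / d\<^sup>2"
            using poisson_kernel_le_far[OF w1 d(1), of \<zeta>] w by (simp add: dist_norm)
          then have "G w * poisson_kernel w \<zeta> \<le> B * ((1 - r\<^sup>2) / d\<^sup>2)"
            using B[of w] w1 k0 Gnn[of w] B0 by (intro mult_mono) auto
          also have "\<dots> < e'" using r(1) by simp
          finally have "G w * poisson_kernel w \<zeta> < e'" .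
          moreover have "0 \<le> e' * poisson_kernel w \<zeta>" "0 \<le> G \<zeta> * poisson_kernel w \<zeta>"
            using e' k0 Gnn by auto
          ultimately show ?thesis by linarith
        qed
      qed
      also have "(\<integral>\<zeta>. G w * poisson_kernel w \<zeta> - e' * poisson_kernel w \<zeta> - e' \<partial>circle_lebesgue)
         = G w * (2 * pi) - e' * (2 * pi) - e' * (2 * pi)"
        using circle_lebesgue.integrable_poisson_kernel[OF w1] poisson_circle_lebesgue[OF w1]
        by (simp add: poisson_def measure_def emeasure_circle_lebesgue_space)
      also have "\<dots> = 2 * pi * G w - e" by (simp add: e'_def)
      finally show ?thesis by (simp add: P)
    qed
    define h where "h w = F w * exp (- herglotz \<nu> w / of_real (2 * pi))" for w
    have nh: "norm (h w) = norm (F w) * exp (- poisson \<nu> w / (2 * pi))" if "norm w < 1" for w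
    proof -
      have "Re (- herglotz \<nu> w / of_real (2 * pi)) = - poisson \<nu> w / (2 * pi)"
        using \<nu>.Re_herglotz[OF that] by (simp only: Re_divide_of_real uminus_complex.sel)
      then show ?thesis unfolding h_def norm_mult norm_exp_eq_Re by simp
    qed
    have hh: "h holomorphic_on ball 0 1"
      unfolding h_def[abs_def] using R
      by (intro holomorphic_intros \<nu>.herglotz_holomorphic holomorphic_on_subset[OF holo]) auto
    have "norm (h z) \<le> exp (e / (2 * pi))"
    proof (rule maximum_modulus_frontier[of h "cball 0 r"])
      show "h holomorphic_on interior (cball 0 r)"
        using r by (intro holomorphic_on_subset[OF hh]) auto
      show "continuous_on (closure (cball 0 r)) h"
        using r by (intro holomorphic_on_imp_continuous_on holomorphic_on_subset[OF hh]) auto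
      show "z \<in> cball 0 r" using r by simp
      fix w assume "w \<in> frontier (cball (0::complex) r)"
      then have w: "norm w = r" by (simp add: frontier_cball)
      have "norm (h w) = norm (F w) * exp (- poisson \<nu> w / (2 * pi))"
        using nh w r by simp
      also have "\<dots> \<le> exp (G w) * exp (e / (2 * pi) - G w)"
        using low[OF w] le_exp_log_plus[of "norm (F w)"]
        by (intro mult_mono) (auto simp: G_def field_simps)
      also have "\<dots> = exp (e / (2 * pi))" by (simp flip: exp_add)
      finally show "norm (h w) \<le> exp (e / (2 * pi))" .
    qed auto
    then have "norm (F z) \<le> exp (e / (2 * pi) + poisson \<nu> z / (2 * pi))"
      unfolding nh[OF z] exp_add by (simp add: exp_minus divide_simps)
    then have "G z \<le> e / (2 * pi) + poisson \<nu> z / (2 * pi)"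
      unfolding G_def using \<nu>.poisson_nonneg[of z] z e by (subst log_plus_le_iff) auto
    then show ?thesis by (simp add: field_simps)
  qed
  then have "2 * pi * G z \<le> poisson \<nu> z"
    by (rule field_le_epsilon)
  then show ?thesis by (simp add: G_def P)
qed

section \<open>The radial maximal function of a Poisson integral\<close>

lemma emeasure_UN_countable_le:
  assumes I: "countable I" and X: "\<And>i. i \<in> I \<Longrightarrow> X i \<in> sets M"
  shows "emeasure M (\<Union>i\<in>I. X i) \<le> (\<integral>\<^sup>+i. emeasure M (X i) \<partial>count_space I)"
proof -
  have U: "(\<Union>i\<in>I. X i) \<in> sets M" using I X by (intro sets.countable_UN') auto
  have "emeasure M (\<Union>i\<in>I. X i) = (\<integral>\<^sup>+x. indicator (\<Union>i\<in>I. X i) x \<partial>M)"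
    using U by simp
  also have "\<dots> \<le> (\<integral>\<^sup>+x. \<integral>\<^sup>+i. indicator (X i) x \<partial>count_space I \<partial>M)"
  proof (rule nn_integral_mono)
    fix x
    show "indicator (\<Union>i\<in>I. X i) x \<le> (\<integral>\<^sup>+i. indicator (X i) x \<partial>count_space I :: ennreal)"
    proof (cases "x \<in> (\<Union>i\<in>I. X i)")
      case True
      then obtain j where j: "j \<in> I" "x \<in> X j" by auto
      then have "indicator (\<Union>i\<in>I. X i) x = (indicator (X j) x :: ennreal)" by (auto simp: indicator_def)
      then show ?thesis
        using nn_integral_ge_point[OF j(1), of "\<lambda>i. indicator (X i) x"] by simp
    qed auto
  qed
  also have "\<dots> = (\<integral>\<^sup>+i. \<integral>\<^sup>+x. indicator (X i) x \<partial>M \<partial>count_space I)"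
    using I X by (intro nn_integral_count_space_nn_integral) auto
  also have "\<dots> = (\<integral>\<^sup>+i. emeasure M (X i) \<partial>count_space I)"
    using X by (intro nn_integral_cong) auto
  finally show ?thesis .
qed

lemma circle_inter_sets:
  "open U \<Longrightarrow> unit_circle \<inter> U \<in> sets circle_borel"
  by (auto simp: sets_restrict_space)

lemma singleton_circle_sets: "norm \<xi> = 1 \<Longrightarrow> {\<xi>} \<in> sets circle_borel"
  by (auto simp: sets_restrict_space image_iff intro!: bexI[of _ "{\<xi>}"])

context circle_measure
begin

lemma circle_inter_open [simp]: "open U \<Longrightarrow> unit_circle \<inter> U \<in> sets \<mu>"
  by (simp add: sets_circle circle_inter_sets)

text \<open>
  With d = 1 - t, the Poisson kernel is at most 32 / d within distance d of \<xi> and at most 32 / (4^k d)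
  at distance between 2^(k-1) d and 2^k d. The mass of the ball of radius 2^k d grows only like 2^k d, so the sum over
  k is geometric.
\<close>
lemma poisson_le_of_ball_bound:
  assumes \<xi>: "norm \<xi> = 1" and t: "0 \<le> t" "t < 1" and c: "0 \<le> c"
    and bound: "\<And>s. 0 < s \<Longrightarrow> s \<le> 6 \<Longrightarrow> measure \<mu> (unit_circle \<inter> ball \<xi> s) \<le> c * s"
  shows "poisson \<mu> (of_real t * \<xi>) \<le> 64 * c"
proof -
  define d where "d = 1 - t"
  have d: "0 < d" "d \<le> 1" using t by (auto simp: d_def)
  define z where "z = of_real t * \<xi>"
  have nz: "norm z = t" using \<xi> t by (simp add: z_def norm_mult)
  have z\<xi>: "norm (\<xi> - z) = d"
  proof -
    have "\<xi> - z = of_real d * \<xi>" by (simp add: z_def d_def algebra_simps)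
    then show ?thesis using \<xi> d by (simp add: norm_mult)
  qed
  have ex: "\<exists>n. 3 < 2 ^ n * d"
  proof -
    obtain n where "3 / d < 2 ^ n" using real_arch_pow[of 2 "3 / d"] by auto
    then show ?thesis using d by (auto simp: field_simps)
  qed
  \<comment> \<open>The circle has diameter 2, so balls of radius beyond 3 need not be considered; minimality of n
    keeps all radii below 6, as Vitali's lemma requires bounded radii.\<close>
  define n where "n = (LEAST n. 3 < 2 ^ n * d)"
  have n: "3 < 2 ^ n * d" unfolding n_def using ex by (rule LeastI_ex)
  have n6: "2 ^ k * d \<le> 6" if "k \<le> n" for k
  proof -
    have "n \<noteq> 0" using n d by (intro notI) simp
    then obtain m where m: "n = Suc m" by (cases n) auto
    have "\<not> 3 < 2 ^ m * d" using not_less_Least[of m "\<lambda>n. 3 < 2 ^ n * d"] m by (simp add: n_def)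
    then have "2 ^ n * d \<le> 6" by (simp add: m not_less mult.commute)
    moreover have "2 ^ k * d \<le> 2 ^ n * d" using that d by (intro mult_right_mono power_increasing) auto
    ultimately show ?thesis by linarith
  qed
  have ptw: "poisson_kernel z \<zeta> \<le> (\<Sum>k\<le>n. 32 / 4 ^ k / d * indicator (unit_circle \<inter> ball \<xi> (2 ^ k * d)) \<zeta>)"
    if \<zeta>: "norm \<zeta> = 1" for \<zeta>
  proof -
    have "dist \<xi> \<zeta> \<le> 2" using \<xi> \<zeta> norm_triangle_ineq4[of \<xi> \<zeta>] by (simp add: dist_norm)
    then have exk: "dist \<xi> \<zeta> < 2 ^ n * d" using n by simp
    define k where "k = (LEAST k. dist \<xi> \<zeta> < 2 ^ k * d)"
    have k: "dist \<xi> \<zeta> < 2 ^ k * d" unfolding k_def using exk by (rule LeastI)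
    have kn: "k \<le> n" unfolding k_def using exk by (rule Least_le)
    have le: "poisson_kernel z \<zeta> \<le> 32 / 4 ^ k / d"
    proof (cases k)
      case 0
      have "poisson_kernel z \<zeta> \<le> 2 / d" using poisson_kernel_le[of z \<zeta>] nz t \<zeta> by (simp add: d_def)
      also have "\<dots> \<le> 32 / 4 ^ k / d" using 0 d by (simp add: divide_simps)
      finally show ?thesis .
    next
      case (Suc m)
      have "\<not> dist \<xi> \<zeta> < 2 ^ m * d"
        using not_less_Least[of m "\<lambda>k. dist \<xi> \<zeta> < 2 ^ k * d"] Suc by (simp add: k_def)
      then have ge: "2 ^ m * d \<le> norm (\<zeta> - \<xi>)" by (simp add: dist_norm norm_minus_commute)
      have "norm (\<zeta> - \<xi>) \<le> norm (\<zeta> - z) + norm (\<xi> - z)"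
        using norm_triangle_ineq4[of "\<zeta> - z" "\<xi> - z"] by simp
      also have "\<dots> \<le> 2 * norm (\<zeta> - z)"
        using z\<xi> dist_circle_lower[OF \<zeta>, of z] nz by (simp add: d_def)
      finally have "2 ^ m * d / 2 \<le> norm (\<zeta> - z)" using ge by simp
      then have "poisson_kernel z \<zeta> \<le> (1 - (norm z)\<^sup>2) / (2 ^ m * d / 2)\<^sup>2"
        using nz t d by (intro poisson_kernel_le_far) auto
      also have "1 - (norm z)\<^sup>2 = d * (1 + t)" by (simp add: nz d_def power2_eq_square algebra_simps)
      also have "d * (1 + t) / (2 ^ m * d / 2)\<^sup>2 \<le> d * 2 / (2 ^ m * d / 2)\<^sup>2"
        using t d by (intro divide_right_mono mult_left_mono) auto
      also have "\<dots> = 32 / 4 ^ k / d"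
      proof -
        have "(2 ^ m * d / 2)\<^sup>2 = 4 ^ m * d\<^sup>2 / 4"
          by (simp add: power_divide power_mult_distrib power2_eq_square flip: power_mult_distrib)
        then show ?thesis using d by (simp add: Suc divide_simps power2_eq_square)
      qed
      finally show ?thesis .
    qed
    also have "\<dots> = 32 / 4 ^ k / d * indicator (unit_circle \<inter> ball \<xi> (2 ^ k * d)) \<zeta>"
      using k \<zeta> by (simp add: indicator_def)
    also have "\<dots> \<le> (\<Sum>k\<le>n. 32 / 4 ^ k / d * indicator (unit_circle \<inter> ball \<xi> (2 ^ k * d)) \<zeta>)"
      using kn d by (intro member_le_sum) auto
    finally show ?thesis .
  qed
  have "poisson \<mu> z \<le> (\<integral>\<zeta>. (\<Sum>k\<le>n. 32 / 4 ^ k / d * indicator (unit_circle \<inter> ball \<xi> (2 ^ k * d)) \<zeta>) \<partial>\<mu>)"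
    unfolding poisson_def
  proof (rule integral_mono)
    show "integrable \<mu> (poisson_kernel z)" using nz t by (intro integrable_poisson_kernel) auto
    show "integrable \<mu> (\<lambda>\<zeta>. \<Sum>k\<le>n. 32 / 4 ^ k / d * indicator (unit_circle \<inter> ball \<xi> (2 ^ k * d)) \<zeta>)"
      by (intro Bochner_Integration.integrable_sum integrable_mult_right integrable_real_indicator)
         (auto simp: less_top[symmetric])
  qed (use ptw in \<open>simp add: space_circle\<close>)
  also have "\<dots> = (\<Sum>k\<le>n. 32 / 4 ^ k / d * measure \<mu> (unit_circle \<inter> ball \<xi> (2 ^ k * d)))"
    by (subst Bochner_Integration.integral_sum)
       (auto simp: less_top[symmetric] intro!: integrable_mult_right integrable_real_indicator)
  also have "\<dots> \<le> (\<Sum>k\<le>n. 32 / 4 ^ k / d * (c * (2 ^ k * d)))"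
    using d by (intro sum_mono mult_left_mono bound n6) auto
  also have "\<dots> = 32 * c * (\<Sum>k\<le>n. (1/2) ^ k)"
    using d unfolding sum_distrib_left
    by (intro sum.cong refl) (simp add: divide_simps flip: power_mult_distrib)
  also have "\<dots> \<le> 32 * c * 2"
  proof (intro mult_left_mono)
    have "(\<Sum>k\<le>n. (1/2::real) ^ k) = 2 - (1/2) ^ n"
      by (induction n) (auto simp: field_simps)
    then show "(\<Sum>k\<le>n. (1/2::real) ^ k) \<le> 2" by simp
  qed (use c in auto)
  finally show ?thesis by (simp add: z_def)
qed

end

text \<open>
  For s < 1 the Poisson kernel of the point (1 - s) \<xi> is at least 1 / (4 s) on the ball, while its
  integral over the circle is 2 \<pi>. For larger s the length of the whole circle is small enough.
\<close>
lemma measure_circle_lebesgue_ball: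
  assumes \<xi>: "norm \<xi> = 1" and s: "0 < s"
  shows "measure circle_lebesgue (unit_circle \<inter> ball \<xi> s) \<le> 8 * pi * s"
proof (cases "s < 1")
  case False
  have "measure circle_lebesgue (unit_circle \<inter> ball \<xi> s) \<le> measure circle_lebesgue (space circle_lebesgue)"
    by (rule circle_lebesgue.bounded_measure)
  also have "\<dots> = 2 * pi" by (simp add: measure_def emeasure_circle_lebesgue_space)
  also have "\<dots> \<le> 8 * pi * s" using False by simp
  finally show ?thesis .
next
  case True
  define z where "z = of_real (1 - s) * \<xi>"
  have nz: "norm z = 1 - s" using \<xi> s True unfolding z_def norm_mult norm_of_real by simp
  have "\<xi> - z = of_real s * \<xi>" by (simp add: z_def algebra_simps)
  then have z\<xi>: "norm (\<xi> - z) = s" using \<xi> s by (simp add: norm_mult)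
  have "measure circle_lebesgue (unit_circle \<inter> ball \<xi> s) / (4 * s)
      = (\<integral>\<zeta>. indicator (unit_circle \<inter> ball \<xi> s) \<zeta> / (4 * s) \<partial>circle_lebesgue)"
    by (subst Bochner_Integration.integral_divide) (auto simp: less_top[symmetric] intro!: integrable_real_indicator)
  also have "\<dots> \<le> poisson circle_lebesgue z"
    unfolding poisson_def
  proof (rule integral_mono)
    show "integrable circle_lebesgue (\<lambda>\<zeta>. indicator (unit_circle \<inter> ball \<xi> s) \<zeta> / (4 * s))"
      by (auto simp: less_top[symmetric] intro!: integrable_real_indicator integrable_divide)
    show "integrable circle_lebesgue (poisson_kernel z)"
      using nz s by (intro circle_lebesgue.integrable_poisson_kernel) auto
    fix \<zeta>
    assume "\<zeta> \<in> space circle_lebesgue"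
    then have \<zeta>: "norm \<zeta> = 1" by (simp add: circle_lebesgue.space_circle)
    show "indicator (unit_circle \<inter> ball \<xi> s) \<zeta> / (4 * s) \<le> poisson_kernel z \<zeta>"
    proof (cases "\<zeta> \<in> ball \<xi> s")
      case True
      have "norm (\<zeta> - z) \<le> norm (\<zeta> - \<xi>) + norm (\<xi> - z)"
        using norm_triangle_ineq[of "\<zeta> - \<xi>" "\<xi> - z"] by simp
      also have "\<dots> \<le> 2 * s" using True z\<xi> by (simp add: dist_norm norm_minus_commute)
      finally have le: "(norm (\<zeta> - z))\<^sup>2 \<le> (2 * s)\<^sup>2" by (intro power_mono) auto
      have pos: "0 < norm (\<zeta> - z)" using dist_circle_lower[OF \<zeta>, of z] nz s by linarith
      have "1 / (4 * s) = s / (2 * s)\<^sup>2" using s by (simp add: power2_eq_square)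
      also have "\<dots> \<le> (1 - (norm z)\<^sup>2) / (norm (\<zeta> - z))\<^sup>2"
      proof (rule frac_le)
        show "s \<le> 1 - (norm z)\<^sup>2" using \<open>s < 1\<close> s by (simp add: nz power2_eq_square algebra_simps)
        then show "0 \<le> 1 - (norm z)\<^sup>2" using s by linarith
      qed (use le pos in auto)
      finally show ?thesis using True \<zeta> by (simp add: poisson_kernel_def)
    qed (use poisson_kernel_nonneg[of z \<zeta>] nz s in auto)
  qed
  also have "\<dots> = 2 * pi" using nz s by (intro poisson_circle_lebesgue) auto
  finally show ?thesis using s by (simp add: field_simps)
qed

text \<open>
  The Hardy-Littlewood argument. A large Poisson integral on the radius to \<xi> forces a ball around \<xi>
  whose \<mu>-mass is large compared with its radius; a Vitali subfamily of these balls is disjoint, and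
  its five-fold enlargement covers F.
\<close>
lemma (in circle_measure) weak_type_radial_maximal:
  assumes F: "F \<in> sets circle_borel" and l: "0 < l"
    and big: "\<And>\<xi>. \<xi> \<in> F \<Longrightarrow> \<exists>t. 0 \<le> t \<and> t < 1 \<and> l < poisson \<mu> (of_real t * \<xi>)"
  shows "emeasure circle_lebesgue F \<le> ennreal (2560 * pi / l * measure \<mu> (space \<mu>))"
proof -
  have FS: "F \<subseteq> unit_circle" using F sets.sets_into_space by (force simp: space_restrict_space)
  have "\<exists>s. 0 < s \<and> s \<le> 6 \<and> l / 64 * s < measure \<mu> (unit_circle \<inter> ball \<xi> s)" if "\<xi> \<in> F" for \<xi>
  proof (rule ccontr)
    assume no: "\<not> ?thesis"
    obtain t where t: "0 \<le> t" "t < 1" "l < poisson \<mu> (of_real t * \<xi>)" using big[OF \<open>\<xi> \<in> F\<close>] by blast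
    have "poisson \<mu> (of_real t * \<xi>) \<le> 64 * (l / 64)"
      using no l t(1,2) that FS by (intro poisson_le_of_ball_bound) (auto simp: not_less)
    then show False using t by simp
  qed
  then obtain r where r: "\<And>\<xi>. \<xi> \<in> F \<Longrightarrow> 0 < r \<xi> \<and> r \<xi> \<le> 6 \<and> l / 64 * r \<xi> < measure \<mu> (unit_circle \<inter> ball \<xi> (r \<xi>))"
    by metis
  have "F \<subseteq> (\<Union>\<xi>\<in>F. ball \<xi> (r \<xi>))" using r by auto
  then obtain C where C: "countable C" "C \<subseteq> F"
      and disj: "pairwise (\<lambda>i j. disjnt (ball i (r i)) (ball j (r j))) C"
      and cov: "F \<subseteq> (\<Union>i\<in>C. ball i (5 * r i))"
    by (rule Vitali_covering_lemma_balls[where a="\<lambda>x. x" and r=r and B=6]) (use r in auto)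
  have "emeasure circle_lebesgue F \<le> emeasure circle_lebesgue (\<Union>i\<in>C. unit_circle \<inter> ball i (5 * r i))"
    using cov FS C(1) by (intro emeasure_mono sets.countable_UN') auto
  also have "\<dots> \<le> (\<integral>\<^sup>+i. emeasure circle_lebesgue (unit_circle \<inter> ball i (5 * r i)) \<partial>count_space C)"
    using C(1) by (intro emeasure_UN_countable_le) auto
  also have "\<dots> \<le> (\<integral>\<^sup>+i. ennreal (2560 * pi / l) * emeasure \<mu> (unit_circle \<inter> ball i (r i)) \<partial>count_space C)"
  proof (rule nn_integral_mono)
    fix i assume "i \<in> space (count_space C)"
    then have i: "i \<in> F" using C by auto
    have "measure circle_lebesgue (unit_circle \<inter> ball i (5 * r i)) \<le> 8 * pi * (5 * r i)"
      using i FS r by (intro measure_circle_lebesgue_ball) auto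
    also have "\<dots> = 2560 * pi / l * (l / 64 * r i)" using l by simp
    also have "\<dots> \<le> 2560 * pi / l * measure \<mu> (unit_circle \<inter> ball i (r i))"
      using r[OF i] l by (intro mult_left_mono) auto
    finally show "emeasure circle_lebesgue (unit_circle \<inter> ball i (5 * r i))
       \<le> ennreal (2560 * pi / l) * emeasure \<mu> (unit_circle \<inter> ball i (r i))"
      using l by (simp add: emeasure_eq_measure circle_lebesgue.emeasure_eq_measure ennreal_leI flip: ennreal_mult)
  qed
  also have "\<dots> = ennreal (2560 * pi / l) * (\<integral>\<^sup>+i. emeasure \<mu> (unit_circle \<inter> ball i (r i)) \<partial>count_space C)"
    by (rule nn_integral_cmult) simp
  also have "(\<integral>\<^sup>+i. emeasure \<mu> (unit_circle \<inter> ball i (r i)) \<partial>count_space C)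
     = emeasure \<mu> (\<Union>i\<in>C. unit_circle \<inter> ball i (r i))"
    using C(1) disj
    by (intro emeasure_UN_countable[symmetric]) (auto simp: disjoint_family_on_def pairwise_def disjnt_def)
  also have "ennreal (2560 * pi / l) * \<dots> \<le> ennreal (2560 * pi / l) * emeasure \<mu> (space \<mu>)"
    by (intro mult_left_mono emeasure_space) auto
  also have "\<dots> = ennreal (2560 * pi / l * measure \<mu> (space \<mu>))"
    using l by (simp add: emeasure_eq_measure flip: ennreal_mult)
  finally show ?thesis .
qed

section \<open>Radial boundedness in the Nevanlinna class\<close>

lemma holomorphic_dilation:
  fixes f :: "complex \<Rightarrow> complex"
  assumes "f holomorphic_on ball 0 1" "0 < \<rho>"
  shows "(\<lambda>z. f (of_real \<rho> * z)) holomorphic_on ball 0 (1 / \<rho>)"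
proof -
  have "f \<circ> (\<lambda>z. of_real \<rho> * z) holomorphic_on ball 0 (1 / \<rho>)"
    using assms by (intro holomorphic_on_compose_gen[OF _ assms(1)] holomorphic_intros)
       (auto simp: norm_mult field_simps)
  then show ?thesis by (simp add: o_def)
qed

lemma nevanlinna_class_mean_bound:
  assumes "f \<in> nevanlinna_class"
  obtains M where "0 \<le> M"
    and "\<And>r. 0 < r \<Longrightarrow> r < 1 \<Longrightarrow> (\<integral>\<zeta>. log_plus (norm (f (of_real r * \<zeta>))) \<partial>circle_lebesgue) \<le> M"
proof -
  have holo: "f holomorphic_on ball 0 1" using assms by (simp add: nevanlinna_class_def)
  obtain K where K: "\<And>r. 0 < r \<Longrightarrow> r < 1 \<Longrightarrow>
      1 / (2 * pi) * integral {0..2 * pi} (\<lambda>\<theta>. log_plus (norm (f (of_real r * cis \<theta>)))) \<le> K"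
    using assms by (fastforce simp: nevanlinna_class_def bdd_above_def)
  show ?thesis
  proof (rule that)
    show "0 \<le> 2 * pi * max 0 K" by simp
    fix r :: real assume r: "0 < r" "r < 1"
    have "continuous_on unit_circle (\<lambda>\<zeta>. f (of_real r * \<zeta>))"
      using r by (intro holomorphic_on_imp_continuous_on
        holomorphic_on_subset[OF holomorphic_dilation[OF holo r(1)]]) (auto simp: field_simps)
    then have "(\<integral>\<zeta>. log_plus (norm (f (of_real r * \<zeta>))) \<partial>circle_lebesgue)
        = integral {0..2 * pi} (\<lambda>\<theta>. log_plus (norm (f (of_real r * cis \<theta>))))"
      by (intro integral_circle_lebesgue continuous_intros)
    also have "\<dots> \<le> 2 * pi * K"
      using K[OF r] by (simp add: field_simps)
    also have "\<dots> \<le> 2 * pi * max 0 K" by (intro mult_left_mono) auto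
    finally show "(\<integral>\<zeta>. log_plus (norm (f (of_real r * \<zeta>))) \<partial>circle_lebesgue) \<le> 2 * pi * max 0 K" .
  qed
qed

text \<open>
  Apply the Poisson majorant and the weak type inequality to the dilations z \<mapsto> f(\<rho> z), which are
  holomorphic across the circle. The resulting measure bound does not depend on \<rho>, so it survives the
  limit \<rho> \<rightarrow> 1 by continuity from below.
\<close>
theorem nevanlinna_class_radially_bounded:
  assumes f: "f \<in> nevanlinna_class"
  shows "AE \<xi> in circle_lebesgue. \<exists>\<Lambda>. \<forall>t. 0 \<le> t \<longrightarrow> t < 1 \<longrightarrow> norm (f (of_real t * \<xi>)) \<le> \<Lambda>"
proof -
  have holo: "f holomorphic_on ball 0 1" using f by (simp add: nevanlinna_class_def)
  obtain M where M: "0 \<le> M"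
    and mean: "\<And>r. 0 < r \<Longrightarrow> r < 1 \<Longrightarrow> (\<integral>\<zeta>. log_plus (norm (f (of_real r * \<zeta>))) \<partial>circle_lebesgue) \<le> M"
    using nevanlinna_class_mean_bound[OF f] by blast
  define \<rho> where "\<rho> n = 1 - 1 / (real n + 2)" for n :: nat
  have \<rho>: "0 < \<rho> n" "\<rho> n < 1" for n by (auto simp: \<rho>_def field_simps)
  have \<rho>_mono: "\<rho> m \<le> \<rho> n" if "m \<le> n" for m n using that by (auto simp: \<rho>_def field_simps)
  have \<rho>_lim: "\<exists>n. t < \<rho> n" if "t < 1" for t
  proof -
    have "\<rho> \<longlonglongrightarrow> 1" unfolding \<rho>_def by real_asymp
    then have "\<forall>\<^sub>F n in sequentially. t < \<rho> n" using that by (rule order_tendstoD)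
    then show ?thesis by (auto simp: eventually_sequentially)
  qed
  define F where "F l n = unit_circle \<inter> (\<Union>t\<in>{0..<\<rho> n}. {z \<in> ball 0 (1 / \<rho> n). l < log_plus (norm (f (of_real t * z)))})"
    for l :: real and n
  have F_sets: "F l n \<in> sets circle_borel" for l n
    unfolding F_def
  proof (intro circle_inter_sets open_UN ballI)
    fix t assume t: "t \<in> {0..<\<rho> n}"
    have "continuous_on (ball 0 (1 / \<rho> n)) (\<lambda>z. f (of_real t * z))"
    proof (intro continuous_on_compose2[OF holomorphic_on_imp_continuous_on[OF holo]] continuous_intros image_subsetI)
      fix z :: complex assume "z \<in> ball 0 (1 / \<rho> n)"
      then have "norm z < 1 / \<rho> n" by simp
      moreover have "t * norm z \<le> \<rho> n * norm z" using t by (intro mult_right_mono) auto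
      ultimately show "of_real t * z \<in> ball 0 1"
        using \<rho>[of n] t by (simp add: norm_mult field_simps)
    qed
    then have "continuous_on (ball 0 (1 / \<rho> n)) (\<lambda>z. log_plus (norm (f (of_real t * z))))"
      by (rule continuous_on_log_plus_norm)
    then have "open (ball 0 (1 / \<rho> n) \<inter> (\<lambda>z. log_plus (norm (f (of_real t * z)))) -` {l<..})"
      by (intro continuous_open_preimage) auto
    also have "ball 0 (1 / \<rho> n) \<inter> (\<lambda>z. log_plus (norm (f (of_real t * z)))) -` {l<..}
       = {z \<in> ball 0 (1 / \<rho> n). l < log_plus (norm (f (of_real t * z)))}" by auto
    finally show "open {z \<in> ball 0 (1 / \<rho> n). l < log_plus (norm (f (of_real t * z)))}" .
  qed
  have F_eq: "\<xi> \<in> F l n \<longleftrightarrow> norm \<xi> = 1 \<and> (\<exists>t. 0 \<le> t \<and> t < \<rho> n \<and> l < log_plus (norm (f (of_real t * \<xi>))))" for \<xi> l n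
    using \<rho>[of n] by (auto simp: F_def)
  have F_le: "emeasure circle_lebesgue (F l n) \<le> ennreal (1280 / l * M)" if l: "0 < l" for l n
  proof -
    define G where "G \<zeta> = log_plus (norm (f (of_real (\<rho> n) * \<zeta>)))" for \<zeta>
    define \<nu> where "\<nu> = density circle_lebesgue (\<lambda>\<zeta>. ennreal (G \<zeta>))"
    have sl: "(\<lambda>z. f (of_real (\<rho> n) * z)) holomorphic_on ball 0 (1 / \<rho> n)"
      using holo \<rho>(1) by (rule holomorphic_dilation)
    then have Gc: "continuous_on unit_circle G"
      unfolding G_def using \<rho>[of n]
      by (intro continuous_intros holomorphic_on_imp_continuous_on holomorphic_on_subset[OF sl])
         (auto simp: field_simps)
    have Gnn: "0 \<le> G \<zeta>" for \<zeta> by (simp add: G_def log_plus_nonneg)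
    interpret \<nu>: circle_measure \<nu>
      unfolding \<nu>_def using Gc Gnn by (rule circle_measure_density)
    have P: "poisson \<nu> w = (\<integral>\<zeta>. G \<zeta> * poisson_kernel w \<zeta> \<partial>circle_lebesgue)" for w
      unfolding \<nu>_def using Gc Gnn by (rule poisson_density)
    have mass: "emeasure \<nu> (space \<nu>) \<le> ennreal M"
    proof -
      have m: "(\<lambda>\<zeta>. ennreal (G \<zeta>)) \<in> borel_measurable circle_lebesgue"
        by (rule measurable_compose[OF borel_measurable_circle_lebesgue[OF Gc] measurable_ennreal])
      have "emeasure \<nu> (space circle_lebesgue) = (\<integral>\<^sup>+\<zeta>. ennreal (G \<zeta>) \<partial>circle_lebesgue)"
        unfolding \<nu>_def
        by (subst emeasure_density[OF m sets.top]) (rule nn_integral_cong, simp)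
      also have "\<dots> = ennreal (\<integral>\<zeta>. G \<zeta> \<partial>circle_lebesgue)"
        using integrable_circle_lebesgue[OF Gc] Gnn by (intro nn_integral_eq_integral) auto
      also have "\<dots> \<le> ennreal M"
        using mean[OF \<rho>] by (intro ennreal_leI) (simp add: G_def)
      finally show ?thesis by (simp add: \<nu>_def)
    qed
    have "emeasure circle_lebesgue (F l n) \<le> ennreal (2560 * pi / (2 * pi * l) * measure \<nu> (space \<nu>))"
    proof (rule \<nu>.weak_type_radial_maximal[OF F_sets])
      show "0 < 2 * pi * l" using l by simp
      fix \<xi> assume "\<xi> \<in> F l n"
      then obtain t where \<xi>: "norm \<xi> = 1" and t: "0 \<le> t" "t < \<rho> n"
          and lt: "l < log_plus (norm (f (of_real t * \<xi>)))"
        by (auto simp: F_eq)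
      define u where "u = t / \<rho> n"
      have u: "0 \<le> u" "u < 1" using t \<rho>[of n] by (auto simp: u_def)
      have "2 * pi * l < 2 * pi * log_plus (norm (f (of_real (\<rho> n) * (of_real u * \<xi>))))"
        using lt \<rho>[of n] by (simp add: u_def)
      also have "\<dots> \<le> poisson \<nu> (of_real u * \<xi>)"
        unfolding P G_def using \<rho>[of n] u \<xi>
        by (intro log_plus_le_poisson[OF sl]) (auto simp: norm_mult)
      finally show "\<exists>t. 0 \<le> t \<and> t < 1 \<and> 2 * pi * l < poisson \<nu> (of_real t * \<xi>)" using u by blast
    qed
    also have "2560 * pi / (2 * pi * l) = 1280 / l" by simp
    also have "ennreal (1280 / l * measure \<nu> (space \<nu>)) \<le> ennreal (1280 / l * M)"
      using mass M l by (intro ennreal_leI mult_left_mono) (auto simp: \<nu>.emeasure_eq_measure)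
    finally show ?thesis .
  qed
  \<comment> \<open>contains every \<xi> on whose radius f is unbounded\<close>
  define N where "N = (\<Inter>m::nat. \<Union>n. F (real (Suc m)) n)"
  have N_sets: "N \<in> sets circle_lebesgue"
    unfolding N_def sets_circle_lebesgue using F_sets by blast
  have "emeasure circle_lebesgue N \<le> ennreal (1280 / real (Suc m) * M)" for m
  proof -
    have "emeasure circle_lebesgue N \<le> emeasure circle_lebesgue (\<Union>n. F (real (Suc m)) n)"
      using F_sets by (intro emeasure_mono) (auto simp: N_def sets_circle_lebesgue)
    also have "\<dots> = (SUP n. emeasure circle_lebesgue (F (real (Suc m)) n))"
    proof (rule SUP_emeasure_incseq[symmetric])
      show "range (F (real (Suc m))) \<subseteq> sets circle_lebesgue"
        using F_sets by (auto simp: sets_circle_lebesgue)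
      show "incseq (F (real (Suc m)))"
        unfolding incseq_def subset_iff F_eq using \<rho>_mono by (meson order_less_le_trans)
    qed
    also have "\<dots> \<le> ennreal (1280 / real (Suc m) * M)"
      by (intro SUP_least F_le) auto
    finally show ?thesis .
  qed
  then have "measure circle_lebesgue N \<le> 1280 / real (Suc m) * M" for m
    using M by (simp add: circle_lebesgue.emeasure_eq_measure)
  moreover have "(\<lambda>m. 1280 / real (Suc m) * M) \<longlonglongrightarrow> 0" by real_asymp
  ultimately have "measure circle_lebesgue N \<le> 0"
    by (intro LIMSEQ_le_const[of _ 0]) auto
  then have "N \<in> null_sets circle_lebesgue"
    using N_sets by (auto simp: null_sets_def circle_lebesgue.emeasure_eq_measure measure_le_0_iff)
  then show ?thesis
  proof (rule AE_I')
    show "{\<xi> \<in> space circle_lebesgue. \<not> (\<exists>\<Lambda>. \<forall>t. 0 \<le> t \<longrightarrow> t < 1 \<longrightarrow> norm (f (of_real t * \<xi>)) \<le> \<Lambda>)} \<subseteq> N"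
    proof safe
      fix \<xi> assume "\<xi> \<in> space circle_lebesgue"
        and unb: "\<nexists>\<Lambda>. \<forall>t. 0 \<le> t \<longrightarrow> t < 1 \<longrightarrow> norm (f (of_real t * \<xi>)) \<le> \<Lambda>"
      then have \<xi>: "norm \<xi> = 1" by (simp add: circle_lebesgue.space_circle)
      show "\<xi> \<in> N"
        unfolding N_def
      proof
        fix m :: nat
        obtain t where t: "0 \<le> t" "t < 1" "exp (real (Suc m)) < norm (f (of_real t * \<xi>))"
          using unb by (meson not_le)
        then have "real (Suc m) < log_plus (norm (f (of_real t * \<xi>)))"
          using log_plus_le_iff[of "norm (f (of_real t * \<xi>))" "real (Suc m)"] by auto
        then show "\<xi> \<in> (\<Union>n. F (real (Suc m)) n)"
          using t \<xi> \<rho>_lim[of t] by (auto simp: F_eq)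
      qed
    qed
  qed
qed

section \<open>Radial behaviour of the Poisson integral of a singular measure\<close>

lemma poisson_kernel_dilation_commute:
  assumes "norm \<xi> = 1" "norm \<zeta> = 1" "0 \<le> r"
  shows "poisson_kernel (of_real r * \<xi>) \<zeta> = poisson_kernel (of_real r * \<zeta>) \<xi>"
proof -
  have *: "norm (\<zeta> - of_real r * \<xi>) = norm (1 - of_real r * \<xi> * cnj \<zeta>)"
    if "norm \<zeta> = 1" for \<zeta> \<xi> :: complex
  proof -
    have "norm (\<zeta> - of_real r * \<xi>) = norm (cnj \<zeta> * (\<zeta> - of_real r * \<xi>))"
      using that by (simp add: norm_mult)
    also have "cnj \<zeta> * (\<zeta> - of_real r * \<xi>) = 1 - of_real r * \<xi> * cnj \<zeta>"
      using that complex_norm_square[of \<zeta>] by (simp add: algebra_simps)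
    finally show ?thesis .
  qed
  have "norm (1 - of_real r * \<xi> * cnj \<zeta>) = norm (cnj (1 - of_real r * \<zeta> * cnj \<xi>))"
    by (simp add: algebra_simps)
  also have "\<dots> = norm (1 - of_real r * \<zeta> * cnj \<xi>)" by (rule complex_mod_cnj)
  finally show ?thesis
    using assms by (simp add: poisson_kernel_def * norm_mult)
qed

text \<open>
  This makes 4 |\<zeta> - \<xi>|^(-2) a common majorant of all the kernels |\<zeta> - r \<xi>|^(-2) along the radius.
\<close>
lemma dist_circle_radial:
  fixes \<xi> \<zeta> :: complex
  assumes "norm \<xi> = 1" "norm \<zeta> = 1" "0 \<le> r" "r \<le> 1"
  shows "norm (\<zeta> - \<xi>) \<le> 2 * norm (\<zeta> - of_real r * \<xi>)"
proof -
  have "\<xi> - of_real r * \<xi> = of_real (1 - r) * \<xi>" by (simp add: algebra_simps)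
  then have "norm (\<xi> - of_real r * \<xi>) = 1 - r" using assms by (simp add: norm_mult del: of_real_diff)
  moreover have "1 - r \<le> norm (\<zeta> - of_real r * \<xi>)"
    using dist_circle_lower[OF assms(2), of "of_real r * \<xi>"] assms by (simp add: norm_mult)
  moreover have "norm (\<zeta> - \<xi>) \<le> norm (\<zeta> - of_real r * \<xi>) + norm (\<xi> - of_real r * \<xi>)"
    using norm_triangle_ineq4[of "\<zeta> - of_real r * \<xi>" "\<xi> - of_real r * \<xi>"] by simp
  ultimately show ?thesis by linarith
qed

text \<open>
  Inner regularity of \<mu>, applied to the null set that carries it.
\<close>
lemma mutually_singular_compact:
  assumes \<mu>: "circle_measure \<mu>" and sing: "mutually_singular \<mu> circle_lebesgue" and e: "0 < e"
  obtains K where "compact K" "K \<subseteq> unit_circle" "K \<in> null_sets circle_lebesgue"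
    "emeasure \<mu> (unit_circle - K) < ennreal e"
proof -
  interpret \<mu>: circle_measure \<mu> by fact
  obtain A where A: "A \<in> null_sets circle_lebesgue" "space \<mu> - A \<in> null_sets \<mu>"
    using sing by (auto simp: mutually_singular_def)
  have Ac: "A \<in> sets circle_borel" using A(1) by (auto simp: sets_circle_lebesgue)
  then have AS: "A \<subseteq> unit_circle" by (auto simp: sets_restrict_space)
  have Ab: "A \<in> sets borel" using Ac
    by (subst (asm) sets_restrict_space_iff) auto
  have m: "(\<lambda>x. x) \<in> measurable \<mu> borel"
    by (rule \<mu>.borel_measurable_circle) simp
  define M where "M = distr \<mu> borel (\<lambda>x. x)"
  have Me: "emeasure M B = emeasure \<mu> (B \<inter> unit_circle)" if "B \<in> sets borel" for B
    unfolding M_def using that by (simp add: emeasure_distr[OF m] \<mu>.space_circle)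
  have reg: "emeasure M A = (SUP K\<in>{K. K \<subseteq> A \<and> compact K}. emeasure M K)"
  proof (rule inner_regular)
    show "emeasure M (space M) \<noteq> \<infinity>"
      using Me[of UNIV] by (simp add: M_def)
  qed (auto simp: M_def Ab)
  have "\<exists>K\<in>{K. K \<subseteq> A \<and> compact K}. emeasure M A < emeasure M K + ennreal e"
    by (rule SUP_approx_ennreal[OF _ _ reg]) (use e Me[OF Ab] in auto)
  then obtain K where K: "K \<subseteq> A" "compact K" "emeasure M A < emeasure M K + ennreal e"
    by auto
  have Kb: "K \<in> sets borel" using K by (simp add: borel_compact)
  have Ks: "K \<in> sets circle_borel"
    using Kb K(1) AS by (auto simp: sets_restrict_space image_iff intro!: bexI[of _ K])
  have "emeasure \<mu> A < emeasure \<mu> K + ennreal e"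
    using K(3) Me[OF Ab] Me[OF Kb] AS K(1) by (simp add: Int_absorb2)
  then have *: "measure \<mu> A < measure \<mu> K + e"
    using e by (simp add: \<mu>.emeasure_eq_measure ennreal_less_iff flip: ennreal_plus)
  have [simp]: "unit_circle - A \<in> sets \<mu>" "A \<in> sets \<mu>" "K \<in> sets \<mu>"
    using A(2) Ac Ks by (auto simp: \<mu>.space_circle \<mu>.sets_circle)
  have "measure \<mu> (unit_circle - K) \<le> measure \<mu> ((unit_circle - A) \<union> (A - K))"
    by (intro \<mu>.finite_measure_mono sets.Un) auto
  also have "\<dots> \<le> measure \<mu> (unit_circle - A) + measure \<mu> (A - K)"
    by (intro measure_Un_le) auto
  also have "measure \<mu> (unit_circle - A) = 0"
    using A(2) by (simp add: \<mu>.space_circle null_sets_def measure_def)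
  also have "measure \<mu> (A - K) = measure \<mu> A - measure \<mu> K"
    using K by (intro \<mu>.finite_measure_Diff) auto
  finally have "emeasure \<mu> (unit_circle - K) < ennreal e"
    using * e by (auto simp: \<mu>.emeasure_eq_measure intro!: ennreal_lessI)
  moreover have "K \<in> null_sets circle_lebesgue"
    using A(1) K(1) Ks by (auto simp: sets_circle_lebesgue intro: null_sets_subset)
  ultimately show ?thesis using that[of K] K AS by auto
qed

text \<open>
  Harmonicity in mean: by symmetry of the kernel in its two boundary points, the Poisson integral of
  a measure has the same integral over every circle around 0.
\<close>
lemma nn_integral_poisson_kernel_swap:
  assumes \<mu>: "circle_measure \<mu>" and B: "B \<in> sets circle_borel" and r: "0 \<le> r" "r < 1"
  shows "(\<integral>\<^sup>+\<xi>. \<integral>\<^sup>+\<zeta>. ennreal (poisson_kernel (of_real r * \<xi>) \<zeta>) * indicator B \<zeta> \<partial>\<mu> \<partial>circle_lebesgue)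
     = ennreal (2 * pi) * emeasure \<mu> B"
proof -
  interpret \<mu>: circle_measure \<mu> by fact
  interpret P: pair_sigma_finite circle_lebesgue \<mu> ..
  have [measurable]: "(\<lambda>x. x) \<in> borel_measurable \<mu>" "(\<lambda>x. x) \<in> borel_measurable circle_lebesgue"
    by (auto intro!: \<mu>.borel_measurable_circle circle_lebesgue.borel_measurable_circle)
  have [measurable]: "B \<in> sets \<mu>" using B by (simp add: \<mu>.sets_circle)
  have "(\<integral>\<^sup>+\<xi>. \<integral>\<^sup>+\<zeta>. ennreal (poisson_kernel (of_real r * \<xi>) \<zeta>) * indicator B \<zeta> \<partial>\<mu> \<partial>circle_lebesgue)
     = (\<integral>\<^sup>+\<zeta>. \<integral>\<^sup>+\<xi>. ennreal (poisson_kernel (of_real r * \<xi>) \<zeta>) * indicator B \<zeta> \<partial>circle_lebesgue \<partial>\<mu>)"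
    unfolding poisson_kernel_def by (rule P.Fubini'[symmetric]) measurable
  also have "\<dots> = (\<integral>\<^sup>+\<zeta>. ennreal (2 * pi) * indicator B \<zeta> \<partial>\<mu>)"
  proof (rule nn_integral_cong)
    fix \<zeta> assume "\<zeta> \<in> space \<mu>"
    then have \<zeta>: "norm \<zeta> = 1" by (simp add: \<mu>.space_circle)
    then have n: "norm (of_real r * \<zeta>) < 1" using r by (simp add: norm_mult)
    have "(\<integral>\<^sup>+\<xi>. ennreal (poisson_kernel (of_real r * \<xi>) \<zeta>) * indicator B \<zeta> \<partial>circle_lebesgue)
       = (\<integral>\<^sup>+\<xi>. ennreal (poisson_kernel (of_real r * \<zeta>) \<xi>) * indicator B \<zeta> \<partial>circle_lebesgue)"
      using r \<zeta> by (intro nn_integral_cong)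
        (simp add: poisson_kernel_dilation_commute[of _ \<zeta>] circle_lebesgue.space_circle)
    also have "\<dots> = (\<integral>\<^sup>+\<xi>. ennreal (poisson_kernel (of_real r * \<zeta>) \<xi>) \<partial>circle_lebesgue) * indicator B \<zeta>"
      by (rule nn_integral_multc)
         (rule measurable_compose[OF circle_lebesgue.borel_measurable_circle[OF poisson_kernel_measurable] measurable_ennreal])
    also have "(\<integral>\<^sup>+\<xi>. ennreal (poisson_kernel (of_real r * \<zeta>) \<xi>) \<partial>circle_lebesgue) = ennreal (2 * pi)"
      using poisson_circle_lebesgue[OF n] circle_lebesgue.integrable_poisson_kernel[OF n] n
      by (subst nn_integral_eq_integral) (auto simp: poisson_def poisson_kernel_nonneg)
    finally show "(\<integral>\<^sup>+\<xi>. ennreal (poisson_kernel (of_real r * \<xi>) \<zeta>) * indicator B \<zeta> \<partial>circle_lebesgue)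
      = ennreal (2 * pi) * indicator B \<zeta>" .
  qed
  also have "\<dots> = ennreal (2 * pi) * emeasure \<mu> B"
    by (rule nn_integral_cmult_indicator) simp
  finally show ?thesis .
qed

text \<open>
  Up to a mass of 1/(k+1) the measure lives on a compact null set. Off this set the Poisson integral
  of the main part tends to 0 along radii, and by Fatou's lemma the lower limit of the remaining part
  has integral at most 2 \<pi> / (k+1). Letting k grow shows that the lower limit vanishes almost everywhere.
\<close>
lemma singular_poisson_radially_small:
  fixes r :: "nat \<Rightarrow> real"
  assumes \<mu>: "circle_measure \<mu>" and sing: "mutually_singular \<mu> circle_lebesgue"
    and r: "\<And>n. 0 \<le> r n" "\<And>n. r n < 1" and r_lim: "r \<longlonglongrightarrow> 1"
  shows "AE \<xi> in circle_lebesgue. \<forall>e>0. \<exists>\<^sub>F n in sequentially. poisson \<mu> (of_real (r n) * \<xi>) < e"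
proof -
  interpret \<mu>: circle_measure \<mu> by fact
  have [measurable]: "(\<lambda>x. x) \<in> borel_measurable \<mu>" "(\<lambda>x. x) \<in> borel_measurable circle_lebesgue"
    by (auto intro!: \<mu>.borel_measurable_circle circle_lebesgue.borel_measurable_circle)
  have "\<exists>K. compact K \<and> K \<subseteq> unit_circle \<and> K \<in> null_sets circle_lebesgue \<and>
      emeasure \<mu> (unit_circle - K) < ennreal (1 / real (Suc k))" for k
    by (rule mutually_singular_compact[OF \<mu> sing, of "1 / real (Suc k)"]) auto
  then obtain K where K: "\<And>k. compact (K k)" "\<And>k. K k \<subseteq> unit_circle"
      "\<And>k. K k \<in> null_sets circle_lebesgue"
      and K_small: "\<And>k. emeasure \<mu> (unit_circle - K k) < ennreal (1 / real (Suc k))"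
    by metis
  define B where "B k = unit_circle - K k" for k
  have Bs: "B k \<in> sets circle_borel" for k
    unfolding B_def unfolding Diff_eq using K(1)[of k]
    by (intro circle_inter_sets open_Compl compact_imp_closed)
  then have [measurable]: "B k \<in> sets \<mu>" for k by (simp add: \<mu>.sets_circle)
  define Q where "Q k n \<xi> = (\<integral>\<^sup>+\<zeta>. ennreal (poisson_kernel (of_real (r n) * \<xi>) \<zeta>) * indicator (B k) \<zeta> \<partial>\<mu>)"
    for k n \<xi>
  have Qm [measurable]: "Q k n \<in> borel_measurable circle_lebesgue" for k n
    unfolding Q_def[abs_def] poisson_kernel_def by measurable
  define L where "L k \<xi> = liminf (\<lambda>n. Q k n \<xi>)" for k \<xi>
  have Lm [measurable]: "L k \<in> borel_measurable circle_lebesgue" for k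
    unfolding L_def[abs_def] by measurable
  have L_le: "(\<integral>\<^sup>+\<xi>. L k \<xi> \<partial>circle_lebesgue) \<le> ennreal (2 * pi * (1 / real (Suc k)))" for k
  proof -
    have "(\<integral>\<^sup>+\<xi>. L k \<xi> \<partial>circle_lebesgue) \<le> liminf (\<lambda>n. \<integral>\<^sup>+\<xi>. Q k n \<xi> \<partial>circle_lebesgue)"
      unfolding L_def by (rule nn_integral_liminf) simp
    also have "(\<lambda>n. \<integral>\<^sup>+\<xi>. Q k n \<xi> \<partial>circle_lebesgue) = (\<lambda>n. ennreal (2 * pi) * emeasure \<mu> (B k))"
      unfolding Q_def using \<mu> Bs r by (subst nn_integral_poisson_kernel_swap) auto
    also have "liminf \<dots> = ennreal (2 * pi) * emeasure \<mu> (B k)"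
      by (rule Liminf_const) simp
    also have "\<dots> \<le> ennreal (2 * pi) * ennreal (1 / real (Suc k))"
      using K_small[of k] by (intro mult_left_mono) (auto simp: B_def)
    also have "\<dots> = ennreal (2 * pi * (1 / real (Suc k)))"
      by (rule ennreal_mult[symmetric]) auto
    finally show ?thesis .
  qed
  \<comment> \<open>at almost every \<xi> some K k leaves a remainder whose lower limit is arbitrarily small\<close>
  define J where "J \<xi> = (INF k. L k \<xi>)" for \<xi>
  have [measurable]: "J \<in> borel_measurable circle_lebesgue" unfolding J_def[abs_def] by measurable
  have "(\<integral>\<^sup>+\<xi>. J \<xi> \<partial>circle_lebesgue) \<le> ennreal (2 * pi * (1 / real (Suc k)))" for k
    using L_le[of k] by (rule order_trans[rotated]) (auto simp: J_def intro!: nn_integral_mono INF_lower)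
  moreover have "(\<lambda>k. ennreal (2 * pi * (1 / real (Suc k)))) \<longlonglongrightarrow> ennreal 0"
    by (intro tendsto_ennrealI) real_asymp
  ultimately have "(\<integral>\<^sup>+\<xi>. J \<xi> \<partial>circle_lebesgue) \<le> ennreal 0"
    by (intro LIMSEQ_le_const[where a="\<integral>\<^sup>+\<xi>. J \<xi> \<partial>circle_lebesgue"]) auto
  then have "(\<integral>\<^sup>+\<xi>. J \<xi> \<partial>circle_lebesgue) = 0" by simp
  then have J0: "AE \<xi> in circle_lebesgue. J \<xi> = 0"
    by (subst (asm) nn_integral_0_iff_AE) auto
  have notK: "AE \<xi> in circle_lebesgue. \<forall>k. \<xi> \<notin> K k"
    using K(3) by (subst AE_all_countable) (auto intro: AE_not_in)
  show ?thesis
    using J0 notK AE_space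
  proof eventually_elim
    case (elim \<xi>)
    then have \<xi>: "norm \<xi> = 1" by (simp add: circle_lebesgue.space_circle)
    show "\<forall>e>0. \<exists>\<^sub>F n in sequentially. poisson \<mu> (of_real (r n) * \<xi>) < e"
    proof (intro allI impI)
      fix e :: real assume e: "0 < e"
      have "(INF k. L k \<xi>) < ennreal (e / 2)" using elim(1) e by (simp add: J_def)
      then obtain k where k: "L k \<xi> < ennreal (e / 2)" by (auto simp: INF_less_iff)
      have freq: "\<exists>\<^sub>F n in sequentially. Q k n \<xi> < ennreal (e / 2)"
      proof (rule ccontr)
        assume "\<not> ?thesis"
        then have "\<forall>\<^sub>F n in sequentially. ennreal (e / 2) \<le> Q k n \<xi>"
          by (simp add: not_frequently not_less)
        then have "ennreal (e / 2) \<le> L k \<xi>" unfolding L_def by (rule Liminf_bounded)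
        then show False using k by simp
      qed
      have "closed (K k)" "\<xi> \<notin> K k" using K(1) elim(2) by (auto intro: compact_imp_closed)
      then obtain d where d: "0 < d" "ball \<xi> d \<subseteq> - K k"
        using open_contains_ball[of "- K k"] by (auto simp: open_Compl)
      have "(\<lambda>n. (1 - (r n)\<^sup>2) / (d / 2)\<^sup>2 * measure \<mu> (space \<mu>)) \<longlonglongrightarrow> (1 - 1\<^sup>2) / (d / 2)\<^sup>2 * measure \<mu> (space \<mu>)"
        using d by (intro tendsto_intros r_lim) auto
      then have ev: "\<forall>\<^sub>F n in sequentially. (1 - (r n)\<^sup>2) / (d / 2)\<^sup>2 * measure \<mu> (space \<mu>) < e / 2"
        by (rule order_tendstoD) (use e in simp)
      show "\<exists>\<^sub>F n in sequentially. poisson \<mu> (of_real (r n) * \<xi>) < e"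
        using frequently_eventually_frequently[OF freq ev]
      proof (rule frequently_elim1, elim conjE)
        fix n assume Qn: "Q k n \<xi> < ennreal (e / 2)"
          and c: "(1 - (r n)\<^sup>2) / (d / 2)\<^sup>2 * measure \<mu> (space \<mu>) < e / 2"
        define z where "z = of_real (r n) * \<xi>"
        have nz: "norm z = r n" using \<xi> r by (simp add: z_def norm_mult)
        have zlt: "norm z < 1" using nz r by simp
        define b where "b = (1 - (r n)\<^sup>2) / (d / 2)\<^sup>2"
        have b0: "0 \<le> b" using r[of n] by (simp add: b_def abs_square_le_1)
        have "ennreal (poisson \<mu> z) = (\<integral>\<^sup>+\<zeta>. ennreal (poisson_kernel z \<zeta>) \<partial>\<mu>)"
          unfolding poisson_def using zlt \<mu>.integrable_poisson_kernel[OF zlt]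
          by (intro nn_integral_eq_integral[symmetric]) (auto simp: poisson_kernel_nonneg)
        also have "\<dots> \<le> (\<integral>\<^sup>+\<zeta>. ennreal (poisson_kernel z \<zeta>) * indicator (B k) \<zeta> + ennreal b \<partial>\<mu>)"
        proof (rule nn_integral_mono)
          fix \<zeta> assume "\<zeta> \<in> space \<mu>"
          then have \<zeta>: "norm \<zeta> = 1" by (simp add: \<mu>.space_circle)
          show "ennreal (poisson_kernel z \<zeta>) \<le> ennreal (poisson_kernel z \<zeta>) * indicator (B k) \<zeta> + ennreal b"
          proof (cases "\<zeta> \<in> B k")
            case False
            then have "\<zeta> \<in> K k" using \<zeta> by (simp add: B_def)
            then have "d \<le> norm (\<zeta> - \<xi>)" using d by (force simp: dist_norm norm_minus_commute)
            then have "d / 2 \<le> norm (\<zeta> - z)"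
              using dist_circle_radial[OF \<xi> \<zeta>, of "r n"] r[of n] by (simp add: z_def)
            then have "poisson_kernel z \<zeta> \<le> b"
              using poisson_kernel_le_far[OF zlt, of "d / 2" \<zeta>] d nz by (simp add: b_def)
            then show ?thesis using False by (simp add: ennreal_leI)
          qed simp
        qed
        also have "\<dots> = Q k n \<xi> + ennreal b * emeasure \<mu> (space \<mu>)"
          unfolding Q_def z_def by (subst nn_integral_add) (auto simp: poisson_kernel_def)
        also have "ennreal b * emeasure \<mu> (space \<mu>) = ennreal (b * measure \<mu> (space \<mu>))"
          using b0 by (simp add: \<mu>.emeasure_eq_measure ennreal_mult)
        also have "Q k n \<xi> + ennreal (b * measure \<mu> (space \<mu>)) < ennreal (e / 2) + ennreal (e / 2)"
          using Qn c e by (intro add_strict_mono) (auto simp: b_def ennreal_less_iff intro: ennreal_lessI)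
        also have "\<dots> = ennreal e" using e by (simp flip: ennreal_plus)
        finally show "poisson \<mu> (of_real (r n) * \<xi>) < e"
          using \<mu>.poisson_nonneg[of z] zlt by (simp add: z_def ennreal_less_iff)
      qed
    qed
  qed
qed

section \<open>Angular derivatives of the singular inner function\<close>

text \<open>
  S is Lipschitz with constant \<Lambda> on the radius and |S| = exp(-P) comes arbitrarily close to 1 towards
  the boundary, so 1 - exp(-P(t \<xi>)) \<le> \<Lambda> (1 - t). Where the right-hand side is at most 1/2 this can be
  solved for P at the price of a factor 2.
\<close>
lemma (in circle_measure) poisson_le_of_radially_bounded_deriv:
  assumes \<xi>: "norm \<xi> = 1"
    and bdd: "\<And>t. 0 \<le> t \<Longrightarrow> t < 1 \<Longrightarrow> norm (deriv (singular_inner \<mu>) (of_real t * \<xi>)) \<le> \<Lambda>"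
    and r: "\<And>n. 0 \<le> r n" "\<And>n. r n < 1" and r_lim: "r \<longlonglongrightarrow> 1"
    and small: "\<And>e. 0 < e \<Longrightarrow> \<exists>\<^sub>F n in sequentially. poisson \<mu> (of_real (r n) * \<xi>) < e"
    and t: "0 \<le> t" "t < 1" and near: "\<Lambda> * (1 - t) \<le> 1 / 2"
  shows "poisson \<mu> (of_real t * \<xi>) \<le> 2 * \<Lambda> * (1 - t)"
proof -
  have \<Lambda>0: "0 \<le> \<Lambda>" using bdd[of 0] norm_ge_zero order_trans by (metis order_refl zero_less_one)
  have S_norm: "norm (singular_inner \<mu> (of_real s * \<xi>)) = exp (- poisson \<mu> (of_real s * \<xi>))"
    if "0 \<le> s" "s < 1" for s
    using that \<xi> by (intro norm_singular_inner) (simp add: norm_mult)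
  have lip: "norm (singular_inner \<mu> (of_real s * \<xi>) - singular_inner \<mu> (of_real t * \<xi>)) \<le> \<Lambda> * (s - t)"
    if s: "t \<le> s" "s < 1" for s
  proof -
    define X where "X = closed_segment (of_real t * \<xi>) (of_real s * \<xi>)"
    have X: "\<exists>u. 0 \<le> u \<and> u < 1 \<and> x = of_real u * \<xi>" if "x \<in> X" for x
    proof -
      obtain v where v: "0 \<le> v" "v \<le> 1" "x = (1 - v) *\<^sub>R (of_real t * \<xi>) + v *\<^sub>R (of_real s * \<xi>)"
        using \<open>x \<in> X\<close> by (auto simp: X_def closed_segment_def)
      define u where "u = (1 - v) * t + v * s"
      have "x = of_real u * \<xi>" using v(3) by (simp add: u_def scaleR_conv_of_real algebra_simps)
      moreover have "0 \<le> u" using v s t by (simp add: u_def)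
      moreover have "u \<le> s" unfolding u_def using convex_bound_le[of t s s "1 - v" v] v s by simp
      ultimately show ?thesis using s by (intro exI[of _ u]) auto
    qed
    have "norm (singular_inner \<mu> (of_real s * \<xi>) - singular_inner \<mu> (of_real t * \<xi>))
        \<le> \<Lambda> * norm (of_real s * \<xi> - of_real t * \<xi>)"
    proof (rule field_differentiable_bound[where S=X])
      show "convex X" by (simp add: X_def)
      fix z assume "z \<in> X"
      then obtain u where u: "0 \<le> u" "u < 1" "z = of_real u * \<xi>" using X by blast
      then have nz: "norm z < 1" using \<xi> by (simp add: norm_mult)
      show "(singular_inner \<mu> has_field_derivative deriv (singular_inner \<mu>) z) (at z within X)"
        using singular_inner_has_field_derivative[OF nz]
        by (metis DERIV_imp_deriv has_field_derivative_at_within)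
      show "norm (deriv (singular_inner \<mu>) z) \<le> \<Lambda>" using bdd u by simp
    qed (auto simp: X_def)
    also have "of_real s * \<xi> - of_real t * \<xi> = of_real (s - t) * \<xi>" by (simp add: algebra_simps)
    also have "norm \<dots> = s - t" unfolding norm_mult norm_of_real using \<xi> s by simp
    finally show ?thesis .
  qed
  define u where "u = \<Lambda> * (1 - t)"
  have u: "0 \<le> u" "u \<le> 1 / 2" using near \<Lambda>0 t by (auto simp: u_def)
  define p where "p = poisson \<mu> (of_real t * \<xi>)"
  have "exp (- e) - u \<le> exp (- p)" if e: "0 < e" for e
  proof -
    have "\<forall>\<^sub>F n in sequentially. t < r n" using r_lim t(2) by (rule order_tendstoD)
    then obtain n where n: "poisson \<mu> (of_real (r n) * \<xi>) < e" "t < r n"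
      using frequently_eventually_frequently[OF small[OF e]] by (auto dest!: frequently_ex)
    have "exp (- e) \<le> exp (- poisson \<mu> (of_real (r n) * \<xi>))" using n by simp
    also have "\<dots> = norm (singular_inner \<mu> (of_real (r n) * \<xi>))" using r by (simp add: S_norm)
    also have "\<dots> \<le> norm (singular_inner \<mu> (of_real t * \<xi>))
        + norm (singular_inner \<mu> (of_real (r n) * \<xi>) - singular_inner \<mu> (of_real t * \<xi>))"
      by (rule norm_triangle_sub)
    also have "\<dots> \<le> exp (- p) + \<Lambda> * (r n - t)"
      using lip[of "r n"] n r t by (simp add: S_norm p_def)
    also have "\<Lambda> * (r n - t) \<le> u" unfolding u_def using r[of n] \<Lambda>0 by (intro mult_left_mono) auto
    finally show ?thesis by simp
  qed
  then have "\<forall>\<^sub>F e in at_right 0. exp (- e) - u \<le> exp (- p)"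
    by (auto simp: eventually_at_right_less intro: eventually_at_rightI[of 0 1])
  moreover have "((\<lambda>e. exp (- e) - u) \<longlongrightarrow> exp (- 0) - u) (at_right 0)"
    by (intro tendsto_intros)
  ultimately have "exp (- 0) - u \<le> exp (- p)"
    by (intro tendsto_upperbound) auto
  then have "1 - u \<le> exp (- p)" by simp
  moreover have "exp (- (2 * u)) \<le> 1 - u"
  proof -
    have "1 \<le> (1 - u) * (1 + 2 * u)"
    proof -
      have "(1 - u) * (1 + 2 * u) - 1 = u * (1 - 2 * u)" by (simp add: algebra_simps)
      moreover have "0 \<le> u * (1 - 2 * u)" using u by simp
      ultimately show ?thesis by linarith
    qed
    also have "\<dots> \<le> (1 - u) * exp (2 * u)"
      using exp_ge_add_one_self[of "2 * u"] u by (intro mult_left_mono) auto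
    finally show ?thesis by (simp add: exp_minus field_simps)
  qed
  ultimately have "exp (- (2 * u)) \<le> exp (- p)" by linarith
  then show ?thesis by (simp add: p_def u_def)
qed

text \<open>
  The hypothesis bounds \<integral> |\<zeta> - t \<xi>|^(-2) d\<mu>(\<zeta>) for t near 1; let t tend to 1 in Fatou's lemma.
  The absence of an atom at \<xi> is a separate claim, because the integrand takes the value 0 at
  \<zeta> = \<xi> instead of infinity.
\<close>
lemma (in circle_measure) angular_derivative_integrable:
  assumes \<xi>: "norm \<xi> = 1"
    and bound: "\<And>t. t0 \<le> t \<Longrightarrow> 0 \<le> t \<Longrightarrow> t < 1 \<Longrightarrow> poisson \<mu> (of_real t * \<xi>) \<le> C * (1 - t)" and t0: "t0 < 1"
  shows "measure \<mu> {\<xi>} = 0" and "integrable \<mu> (\<lambda>\<zeta>. 1 / (norm (\<zeta> - \<xi>))\<^sup>2)"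
proof -
  define r where "r n = max (max 0 t0) (1 - 1 / (real n + 1))" for n :: nat
  have r: "0 \<le> r n" "t0 \<le> r n" "r n < 1" for n using t0 by (auto simp: r_def)
  have "(\<lambda>n. max (max 0 t0) (1 - 1 / (real n + 1))) \<longlonglongrightarrow> max (max 0 t0) 1"
    by (intro tendsto_max tendsto_const) real_asymp
  then have r_lim: "r \<longlonglongrightarrow> 1" using t0 by (simp add: r_def[abs_def])
  define K where "K n \<zeta> = 1 / (norm (\<zeta> - of_real (r n) * \<xi>))\<^sup>2" for n \<zeta>
  have nz: "norm (of_real (r n) * \<xi>) < 1" for n using \<xi> r[of n] by (simp add: norm_mult)
  have Kpk: "K n \<zeta> = poisson_kernel (of_real (r n) * \<xi>) \<zeta> / (1 - (r n)\<^sup>2)" for n \<zeta>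
  proof -
    have "(r n)\<^sup>2 < 1" using r[of n] by (simp add: abs_square_less_1)
    then show ?thesis using \<xi> r[of n] by (simp add: K_def poisson_kernel_def norm_mult)
  qed
  have Kint: "integrable \<mu> (K n)" for n
    unfolding Kpk using integrable_poisson_kernel[OF nz] by simp
  have Kle: "(\<integral>\<zeta>. K n \<zeta> \<partial>\<mu>) \<le> C" for n
  proof -
    have "(\<integral>\<zeta>. K n \<zeta> \<partial>\<mu>) = poisson \<mu> (of_real (r n) * \<xi>) / (1 - (r n)\<^sup>2)"
      unfolding Kpk poisson_def by simp
    also have "\<dots> \<le> poisson \<mu> (of_real (r n) * \<xi>) / (1 - r n)"
    proof (rule divide_left_mono)
      have "(r n)\<^sup>2 \<le> r n" using r[of n] by (simp add: power2_eq_square mult_left_le)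
      then show "1 - r n \<le> 1 - (r n)\<^sup>2" by simp
      then show "0 < (1 - (r n)\<^sup>2) * (1 - r n)" using r[of n] by (intro mult_pos_pos) auto
    qed (use nz in \<open>auto intro: poisson_nonneg less_imp_le\<close>)
    also have "\<dots> \<le> C" using bound[of "r n"] r[of n] by (simp add: field_simps)
    finally show ?thesis .
  qed
  have sing: "{\<xi>} \<in> sets \<mu>"
    using singleton_circle_sets[OF \<xi>] by (simp add: sets_circle)
  have atom: "measure \<mu> {\<xi>} \<le> C * (1 - r n)\<^sup>2" for n
  proof -
    have "norm (\<xi> - of_real (r n) * \<xi>) = norm (of_real (1 - r n) * \<xi>)" by (simp add: algebra_simps)
    also have "\<dots> = 1 - r n" unfolding norm_mult norm_of_real using \<xi> r[of n] by simp
    finally have dK: "K n \<xi> = 1 / (1 - r n)\<^sup>2" by (simp add: K_def)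
    have "measure \<mu> {\<xi>} / (1 - r n)\<^sup>2 = (\<integral>\<zeta>. indicator {\<xi>} \<zeta> / (1 - r n)\<^sup>2 \<partial>\<mu>)"
      using sing by simp
    also have "\<dots> \<le> (\<integral>\<zeta>. K n \<zeta> \<partial>\<mu>)"
      using sing dK by (intro integral_mono Kint integrable_divide integrable_real_indicator)
        (auto simp: less_top[symmetric] indicator_def K_def)
    also have "\<dots> \<le> C" by (rule Kle)
    finally show ?thesis using r[of n] by (simp add: field_simps)
  qed
  have "(\<lambda>n. C * (1 - r n)\<^sup>2) \<longlonglongrightarrow> C * (1 - 1)\<^sup>2" by (intro tendsto_intros r_lim)
  then have "measure \<mu> {\<xi>} \<le> C * (1 - 1)\<^sup>2"
    using atom by (intro LIMSEQ_le_const) auto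
  then show atom0: "measure \<mu> {\<xi>} = 0" by (simp add: measure_le_0_iff)
  have Km: "(\<lambda>\<zeta>. ennreal (K n \<zeta>)) \<in> borel_measurable \<mu>" for n
    by (rule measurable_compose[OF borel_measurable_integrable[OF Kint] measurable_ennreal])
  have ne: "AE \<zeta> in \<mu>. \<zeta> \<noteq> \<xi>"
  proof -
    have "{\<xi>} \<in> null_sets \<mu>" using sing atom0 by (auto simp: null_sets_def emeasure_eq_measure)
    then have "AE \<zeta> in \<mu>. \<zeta> \<notin> {\<xi>}" by (rule AE_not_in)
    then show ?thesis by simp
  qed
  have "(\<integral>\<^sup>+\<zeta>. ennreal (1 / (norm (\<zeta> - \<xi>))\<^sup>2) \<partial>\<mu>) = (\<integral>\<^sup>+\<zeta>. liminf (\<lambda>n. ennreal (K n \<zeta>)) \<partial>\<mu>)"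
  proof (rule nn_integral_cong_AE)
    show "AE \<zeta> in \<mu>. ennreal (1 / (norm (\<zeta> - \<xi>))\<^sup>2) = liminf (\<lambda>n. ennreal (K n \<zeta>))"
      using ne
    proof eventually_elim
      case (elim \<zeta>)
      have "(\<lambda>n. K n \<zeta>) \<longlonglongrightarrow> 1 / (norm (\<zeta> - of_real 1 * \<xi>))\<^sup>2"
        unfolding K_def using elim by (intro tendsto_intros tendsto_of_real r_lim) auto
      then have "(\<lambda>n. ennreal (K n \<zeta>)) \<longlonglongrightarrow> ennreal (1 / (norm (\<zeta> - \<xi>))\<^sup>2)"
        by (intro tendsto_ennrealI) simp
      then show ?case by (intro lim_imp_Liminf[symmetric]) auto
    qed
  qed
  also have "\<dots> \<le> liminf (\<lambda>n. \<integral>\<^sup>+\<zeta>. ennreal (K n \<zeta>) \<partial>\<mu>)"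
    by (rule nn_integral_liminf) (rule Km)
  also have "\<dots> \<le> liminf (\<lambda>n::nat. ennreal C)"
  proof (rule Liminf_mono, rule always_eventually, rule allI)
    fix n
    have "(\<integral>\<^sup>+\<zeta>. ennreal (K n \<zeta>) \<partial>\<mu>) = ennreal (\<integral>\<zeta>. K n \<zeta> \<partial>\<mu>)"
      by (rule nn_integral_eq_integral[OF Kint]) (simp add: K_def)
    then show "(\<integral>\<^sup>+\<zeta>. ennreal (K n \<zeta>) \<partial>\<mu>) \<le> ennreal C" using Kle by (simp add: ennreal_leI)
  qed
  also have "\<dots> = ennreal C" by (rule Liminf_const) simp
  finally have fin: "(\<integral>\<^sup>+\<zeta>. ennreal (1 / (norm (\<zeta> - \<xi>))\<^sup>2) \<partial>\<mu>) < \<infinity>"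
    using ennreal_less_top[of C] by (simp add: le_less_trans)
  show "integrable \<mu> (\<lambda>\<zeta>. 1 / (norm (\<zeta> - \<xi>))\<^sup>2)"
  proof (rule integrableI_nonneg)
    show "(\<lambda>\<zeta>. 1 / (norm (\<zeta> - \<xi>))\<^sup>2) \<in> borel_measurable \<mu>"
      by (rule borel_measurable_circle) measurable
  qed (use fin in auto)
qed

text \<open>
  In S'(z) = - S(z) \<integral> 2 \<zeta> / (\<zeta> - z)^2 d\<mu>(\<zeta>) dominated convergence applies along the radius. On the
  boundary \<zeta> / (\<zeta> - \<xi>)^2 equals -1 / (\<xi> |\<zeta> - \<xi>|^2), so there is no cancellation in the limit, and
  |S| tends to 1 because P(r \<xi>) \<le> 4 (1 - r^2) D(\<xi>).
\<close>
lemma (in circle_measure) radial_limit_norm_deriv_singular_inner: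
  assumes \<xi>: "norm \<xi> = 1" and atom: "measure \<mu> {\<xi>} = 0"
    and int: "integrable \<mu> (\<lambda>\<zeta>. 1 / (norm (\<zeta> - \<xi>))\<^sup>2)"
    and r: "\<And>n. 0 \<le> r n" "\<And>n. r n < 1" and r_lim: "r \<longlonglongrightarrow> 1"
  shows "(\<lambda>n. norm (deriv (singular_inner \<mu>) (of_real (r n) * \<xi>)))
     \<longlonglongrightarrow> 2 * (\<integral>\<zeta>. 1 / (norm (\<zeta> - \<xi>))\<^sup>2 \<partial>\<mu>)"
proof -
  define D where "D = (\<integral>\<zeta>. 1 / (norm (\<zeta> - \<xi>))\<^sup>2 \<partial>\<mu>)"
  define z where "z n = of_real (r n) * \<xi>" for n
  have nz: "norm (z n) < 1" for n using \<xi> r[of n] by (simp add: z_def norm_mult)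
  have z_lim: "z \<longlonglongrightarrow> \<xi>"
  proof -
    have "z \<longlonglongrightarrow> of_real 1 * \<xi>" unfolding z_def[abs_def] by (intro tendsto_intros tendsto_of_real r_lim)
    then show ?thesis by simp
  qed
  have sing: "{\<xi>} \<in> sets \<mu>"
    using singleton_circle_sets[OF \<xi>] by (simp add: sets_circle)
  have ne: "AE \<zeta> in \<mu>. norm \<zeta> = 1 \<and> \<zeta> \<noteq> \<xi>"
  proof -
    have "{\<xi>} \<in> null_sets \<mu>" using sing atom by (auto simp: null_sets_def emeasure_eq_measure)
    then have "AE \<zeta> in \<mu>. \<zeta> \<notin> {\<xi>}" by (rule AE_not_in)
    with AE_space show ?thesis by eventually_elim (simp add: space_circle)
  qed
  have near: "1 / (norm (\<zeta> - z n))\<^sup>2 \<le> 4 * (1 / (norm (\<zeta> - \<xi>))\<^sup>2)" if "norm \<zeta> = 1" "\<zeta> \<noteq> \<xi>" for \<zeta> n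
  proof -
    have le: "norm (\<zeta> - \<xi>) \<le> 2 * norm (\<zeta> - z n)"
      unfolding z_def using \<xi> that(1) r[of n] by (intro dist_circle_radial) auto
    then have "(norm (\<zeta> - \<xi>))\<^sup>2 \<le> (2 * norm (\<zeta> - z n))\<^sup>2" by (intro power_mono) auto
    moreover have "0 < norm (\<zeta> - z n)" "0 < norm (\<zeta> - \<xi>)" using le that(2) by (auto intro: ccontr)
    ultimately show ?thesis by (simp add: field_simps power_mult_distrib)
  qed
  have poisson_le: "poisson \<mu> (z n) \<le> (1 - (r n)\<^sup>2) * (4 * D)" for n
  proof -
    have r1: "0 \<le> 1 - (r n)\<^sup>2" using r[of n] by (simp add: abs_square_le_1)
    have "poisson \<mu> (z n) \<le> (\<integral>\<zeta>. (1 - (r n)\<^sup>2) * (4 * (1 / (norm (\<zeta> - \<xi>))\<^sup>2)) \<partial>\<mu>)"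
      unfolding poisson_def
    proof (rule integral_mono_AE)
      show "AE \<zeta> in \<mu>. poisson_kernel (z n) \<zeta> \<le> (1 - (r n)\<^sup>2) * (4 * (1 / (norm (\<zeta> - \<xi>))\<^sup>2))"
        using ne
      proof eventually_elim
        case (elim \<zeta>)
        have "poisson_kernel (z n) \<zeta> = (1 - (r n)\<^sup>2) * (1 / (norm (\<zeta> - z n))\<^sup>2)"
          using \<xi> r[of n] by (simp add: poisson_kernel_def z_def norm_mult)
        also have "\<dots> \<le> (1 - (r n)\<^sup>2) * (4 * (1 / (norm (\<zeta> - \<xi>))\<^sup>2))"
          using near[of \<zeta> n] elim r1 by (intro mult_left_mono) auto
        finally show ?case .
      qed
    qed (intro integrable_poisson_kernel nz integrable_mult_right int)+
    also have "\<dots> = (1 - (r n)\<^sup>2) * (4 * D)" unfolding D_def by (simp only: integral_mult_right_zero)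
    finally show ?thesis .
  qed
  have "(\<lambda>n. poisson \<mu> (z n)) \<longlonglongrightarrow> 0"
  proof (rule tendsto_sandwich[where f="\<lambda>_. 0" and h="\<lambda>n. (1 - (r n)\<^sup>2) * (4 * D)"])
    have "(\<lambda>n. (1 - (r n)\<^sup>2) * (4 * D)) \<longlonglongrightarrow> (1 - 1\<^sup>2) * (4 * D)" by (intro tendsto_intros r_lim)
    then show "(\<lambda>n. (1 - (r n)\<^sup>2) * (4 * D)) \<longlonglongrightarrow> 0" by simp
    show "\<forall>\<^sub>F n in sequentially. 0 \<le> poisson \<mu> (z n)" using poisson_nonneg[OF less_imp_le[OF nz]] by simp
  qed (use poisson_le in \<open>auto intro!: always_eventually\<close>)
  then have "(\<lambda>n. exp (- poisson \<mu> (z n))) \<longlonglongrightarrow> exp (- 0)" by (intro tendsto_intros)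
  then have S_lim: "(\<lambda>n. norm (singular_inner \<mu> (z n))) \<longlonglongrightarrow> 1" by (simp add: norm_singular_inner[OF nz])
  have "(\<lambda>n. \<integral>\<zeta>. 2 * \<zeta> / (\<zeta> - z n)\<^sup>2 \<partial>\<mu>) \<longlonglongrightarrow> (\<integral>\<zeta>. 2 * \<zeta> / (\<zeta> - \<xi>)\<^sup>2 \<partial>\<mu>)"
  proof (rule integral_dominated_convergence)
    show "integrable \<mu> (\<lambda>\<zeta>. 2 * (4 * (1 / (norm (\<zeta> - \<xi>))\<^sup>2)))" by (intro integrable_mult_right int)
    show "AE \<zeta> in \<mu>. (\<lambda>n. 2 * \<zeta> / (\<zeta> - z n)\<^sup>2) \<longlonglongrightarrow> 2 * \<zeta> / (\<zeta> - \<xi>)\<^sup>2"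
      using ne by eventually_elim (intro tendsto_intros z_lim, auto)
    show "AE \<zeta> in \<mu>. norm (2 * \<zeta> / (\<zeta> - z n)\<^sup>2) \<le> 2 * (4 * (1 / (norm (\<zeta> - \<xi>))\<^sup>2))" for n
      using ne
    proof eventually_elim
      case (elim \<zeta>)
      then have "2 * (1 / (norm (\<zeta> - z n))\<^sup>2) \<le> 2 * (4 * (1 / (norm (\<zeta> - \<xi>))\<^sup>2))"
        by (intro mult_left_mono near) auto
      then show ?case using elim by (simp add: norm_divide norm_mult norm_power)
    qed
    show "(\<lambda>\<zeta>. 2 * \<zeta> / (\<zeta> - \<xi>)\<^sup>2) \<in> borel_measurable \<mu>" by (rule borel_measurable_circle) measurable
    show "(\<lambda>\<zeta>. 2 * \<zeta> / (\<zeta> - z n)\<^sup>2) \<in> borel_measurable \<mu>" for n by (rule borel_measurable_circle) measurable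
  qed
  also have "(\<integral>\<zeta>. 2 * \<zeta> / (\<zeta> - \<xi>)\<^sup>2 \<partial>\<mu>) = (\<integral>\<zeta>. (- 2 * cnj \<xi>) * of_real (1 / (norm (\<zeta> - \<xi>))\<^sup>2) \<partial>\<mu>)"
  proof (rule integral_cong_AE)
    show "AE \<zeta> in \<mu>. 2 * \<zeta> / (\<zeta> - \<xi>)\<^sup>2 = (- 2 * cnj \<xi>) * of_real (1 / (norm (\<zeta> - \<xi>))\<^sup>2)"
      using ne
    proof eventually_elim
      case (elim \<zeta>)
      have \<zeta>c: "\<zeta> * cnj \<zeta> = 1" "\<xi> * cnj \<xi> = 1"
        using elim \<xi> complex_norm_square[of \<zeta>] complex_norm_square[of \<xi>] by auto
      have "complex_of_real ((norm (\<zeta> - \<xi>))\<^sup>2) = (\<zeta> - \<xi>) * (cnj \<zeta> - cnj \<xi>)"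
        using complex_norm_square[of "\<zeta> - \<xi>"] by simp
      moreover have "\<zeta> * (cnj \<zeta> - cnj \<xi>) = - cnj \<xi> * (\<zeta> - \<xi>)" using \<zeta>c by (simp add: algebra_simps)
      ultimately have "\<zeta> * of_real ((norm (\<zeta> - \<xi>))\<^sup>2) = (\<zeta> - \<xi>) * (- cnj \<xi> * (\<zeta> - \<xi>))"
        by (metis mult.left_commute)
      then have "\<zeta> * of_real ((norm (\<zeta> - \<xi>))\<^sup>2) = - cnj \<xi> * (\<zeta> - \<xi>)\<^sup>2"
        by (simp add: power2_eq_square mult_ac)
      moreover have "complex_of_real ((norm (\<zeta> - \<xi>))\<^sup>2) \<noteq> 0" "(\<zeta> - \<xi>)\<^sup>2 \<noteq> 0" using elim by auto
      ultimately have "\<zeta> / (\<zeta> - \<xi>)\<^sup>2 = - cnj \<xi> / of_real ((norm (\<zeta> - \<xi>))\<^sup>2)"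
        by (subst frac_eq_eq)
      then have "2 * (\<zeta> / (\<zeta> - \<xi>)\<^sup>2) = 2 * (- cnj \<xi> / of_real ((norm (\<zeta> - \<xi>))\<^sup>2))" by (rule arg_cong)
      then show ?case by simp
    qed
    show "(\<lambda>\<zeta>. 2 * \<zeta> / (\<zeta> - \<xi>)\<^sup>2) \<in> borel_measurable \<mu>" by (rule borel_measurable_circle) measurable
    show "(\<lambda>\<zeta>. (- 2 * cnj \<xi>) * of_real (1 / (norm (\<zeta> - \<xi>))\<^sup>2)) \<in> borel_measurable \<mu>"
      by (rule borel_measurable_circle) measurable
  qed
  also have "\<dots> = (- 2 * cnj \<xi>) * of_real D"
    unfolding D_def using int by (subst integral_mult_right_zero) (simp only: integral_complex_of_real)
  finally have "(\<lambda>n. norm (\<integral>\<zeta>. 2 * \<zeta> / (\<zeta> - z n)\<^sup>2 \<partial>\<mu>)) \<longlonglongrightarrow> norm ((- 2 * cnj \<xi>) * of_real D)"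
    by (rule tendsto_norm)
  moreover have "0 \<le> D" unfolding D_def by (rule integral_nonneg_AE) auto
  ultimately have H_lim: "(\<lambda>n. norm (\<integral>\<zeta>. 2 * \<zeta> / (\<zeta> - z n)\<^sup>2 \<partial>\<mu>)) \<longlonglongrightarrow> 2 * D"
    using \<xi> by (simp add: norm_mult)
  have "deriv (singular_inner \<mu>) (z n) = - (\<integral>\<zeta>. 2 * \<zeta> / (\<zeta> - z n)\<^sup>2 \<partial>\<mu>) * singular_inner \<mu> (z n)" for n
    by (rule DERIV_imp_deriv[OF singular_inner_has_field_derivative[OF nz]])
  then have "(\<lambda>n. norm (deriv (singular_inner \<mu>) (z n)))
     = (\<lambda>n. norm (\<integral>\<zeta>. 2 * \<zeta> / (\<zeta> - z n)\<^sup>2 \<partial>\<mu>) * norm (singular_inner \<mu> (z n)))"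
    by (simp add: norm_mult)
  with tendsto_mult[OF H_lim S_lim] show ?thesis by (simp add: z_def D_def)
qed

lemma (in circle_measure) measure_le_dist_sq:
  assumes atom: "measure \<mu> {\<xi>} = 0" and int: "integrable \<mu> (\<lambda>\<zeta>. 1 / (norm (\<zeta> - \<xi>))\<^sup>2)"
    and Q: "Q \<in> sets \<mu>" and d: "0 < d" "\<And>\<zeta>. \<zeta> \<in> Q \<Longrightarrow> dist \<zeta> \<xi> \<le> d" and \<xi>: "norm \<xi> = 1"
  shows "measure \<mu> Q / d\<^sup>2 \<le> (\<integral>\<zeta>. 1 / (norm (\<zeta> - \<xi>))\<^sup>2 \<partial>\<mu>)"
proof -
  have sing: "{\<xi>} \<in> sets \<mu>"
    using singleton_circle_sets[OF \<xi>] by (simp add: sets_circle)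
  have "{\<xi>} \<in> null_sets \<mu>" using sing atom by (auto simp: null_sets_def emeasure_eq_measure)
  then have ne: "AE \<zeta> in \<mu>. \<zeta> \<notin> {\<xi>}" by (rule AE_not_in)
  have "measure \<mu> Q / d\<^sup>2 = (\<integral>\<zeta>. indicator Q \<zeta> / d\<^sup>2 \<partial>\<mu>)" using Q by simp
  also have "\<dots> \<le> (\<integral>\<zeta>. 1 / (norm (\<zeta> - \<xi>))\<^sup>2 \<partial>\<mu>)"
  proof (rule integral_mono_AE)
    show "AE \<zeta> in \<mu>. indicator Q \<zeta> / d\<^sup>2 \<le> 1 / (norm (\<zeta> - \<xi>))\<^sup>2"
      using ne
    proof eventually_elim
      case (elim \<zeta>)
      show ?case
      proof (cases "\<zeta> \<in> Q")
        case True
        then have "(norm (\<zeta> - \<xi>))\<^sup>2 \<le> d\<^sup>2" using d(2)[OF True] by (intro power_mono) (auto simp: dist_norm)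
        then show ?thesis using True elim d(1) by (auto intro!: divide_left_mono mult_pos_pos)
      qed simp
    qed
  qed (use Q int in \<open>auto simp: less_top[symmetric] intro!: integrable_divide integrable_real_indicator\<close>)
  finally show ?thesis .
qed

text \<open>
  The function \<phi> is the lower limit of log^+ |S'| along radii; almost everywhere it is log^+(2 D).
  The last clause is all that the dyadic construction needs to know about D: a set of mass m within
  distance d of \<xi> contributes at least m / d^2.
\<close>
theorem singular_inner_deriv_nevanlinna_boundary:
  assumes \<mu>: "circle_measure \<mu>" and sing: "mutually_singular \<mu> circle_lebesgue"
    and nev: "deriv (singular_inner \<mu>) \<in> nevanlinna_class"
  obtains \<phi> :: "complex \<Rightarrow> ennreal" where "\<phi> \<in> borel_measurable circle_lebesgue"
    and "(\<integral>\<^sup>+\<xi>. \<phi> \<xi> \<partial>circle_lebesgue) < \<infinity>"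
    and "AE \<xi> in circle_lebesgue. \<forall>Q d. Q \<in> sets \<mu> \<longrightarrow> 0 < d \<longrightarrow> (\<forall>\<zeta>\<in>Q. dist \<zeta> \<xi> \<le> d) \<longrightarrow>
        ennreal (log_plus (2 * (measure \<mu> Q / d\<^sup>2))) \<le> \<phi> \<xi>"
proof -
  interpret \<mu>: circle_measure \<mu> by fact
  define f where "f = deriv (singular_inner \<mu>)"
  define r where "r n = 1 - 1 / (real n + 2)" for n :: nat
  have r: "0 \<le> r n" "0 < r n" "r n < 1" for n by (auto simp: r_def field_simps)
  have r_lim: "r \<longlonglongrightarrow> 1" unfolding r_def by real_asymp
  have holo: "f holomorphic_on ball 0 1" using nev by (simp add: nevanlinna_class_def f_def)
  obtain M where M: "0 \<le> M"
    and mean: "\<And>r. 0 < r \<Longrightarrow> r < 1 \<Longrightarrow> (\<integral>\<zeta>. log_plus (norm (f (of_real r * \<zeta>))) \<partial>circle_lebesgue) \<le> M"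
    using nevanlinna_class_mean_bound[OF nev] unfolding f_def by blast
  have c: "continuous_on unit_circle (\<lambda>\<xi>. log_plus (norm (f (of_real (r n) * \<xi>))))" for n
    using r[of n]
    by (intro continuous_intros holomorphic_on_imp_continuous_on
      holomorphic_on_subset[OF holomorphic_dilation[OF holo r(2)]]) (auto simp: field_simps)
  have m: "(\<lambda>\<xi>. ennreal (log_plus (norm (f (of_real (r n) * \<xi>))))) \<in> borel_measurable circle_lebesgue" for n
    by (rule measurable_compose[OF borel_measurable_circle_lebesgue[OF c] measurable_ennreal])
  define \<phi> where "\<phi> \<xi> = liminf (\<lambda>n. ennreal (log_plus (norm (f (of_real (r n) * \<xi>)))))" for \<xi>
  have "AE \<xi> in circle_lebesgue. \<forall>Q d. Q \<in> sets \<mu> \<longrightarrow> 0 < d \<longrightarrow> (\<forall>\<zeta>\<in>Q. dist \<zeta> \<xi> \<le> d) \<longrightarrow>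
        ennreal (log_plus (2 * (measure \<mu> Q / d\<^sup>2))) \<le> \<phi> \<xi>"
    using nevanlinna_class_radially_bounded[OF nev]
      singular_poisson_radially_small[OF \<mu> sing r(1,3) r_lim] AE_space
  proof eventually_elim
    case (elim \<xi>)
    then have \<xi>: "norm \<xi> = 1" by (simp add: circle_lebesgue.space_circle)
    obtain \<Lambda>' where \<Lambda>': "\<forall>t. 0 \<le> t \<longrightarrow> t < 1 \<longrightarrow> norm (deriv (singular_inner \<mu>) (of_real t * \<xi>)) \<le> \<Lambda>'"
      using elim(1) by blast
    define \<Lambda> where "\<Lambda> = max 1 \<Lambda>'"
    have \<Lambda>: "norm (deriv (singular_inner \<mu>) (of_real t * \<xi>)) \<le> \<Lambda>" if "0 \<le> t" "t < 1" for t
      using \<Lambda>' that by (fastforce simp: \<Lambda>_def)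
    have \<Lambda>1: "1 \<le> \<Lambda>" by (simp add: \<Lambda>_def)
    have P: "poisson \<mu> (of_real t * \<xi>) \<le> 2 * \<Lambda> * (1 - t)"
      if "1 - 1 / (2 * \<Lambda>) \<le> t" "0 \<le> t" "t < 1" for t
    proof (rule \<mu>.poisson_le_of_radially_bounded_deriv[OF \<xi> \<Lambda> r(1,3) r_lim _ that(2,3)])
      have "1 - t \<le> 1 / (2 * \<Lambda>)" using that by simp
      then show "\<Lambda> * (1 - t) \<le> 1 / 2" using \<Lambda>1 by (simp add: field_simps)
    qed (use elim(2) in auto)
    have lt: "1 - 1 / (2 * \<Lambda>) < 1" using \<Lambda>1 by simp
    have atom: "measure \<mu> {\<xi>} = 0" and int: "integrable \<mu> (\<lambda>\<zeta>. 1 / (norm (\<zeta> - \<xi>))\<^sup>2)"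
      using \<mu>.angular_derivative_integrable[OF \<xi> P lt] by blast+
    define D where "D = (\<integral>\<zeta>. 1 / (norm (\<zeta> - \<xi>))\<^sup>2 \<partial>\<mu>)"
    have D0: "0 \<le> D" unfolding D_def by (rule integral_nonneg_AE) auto
    have lim: "(\<lambda>n. norm (f (of_real (r n) * \<xi>))) \<longlonglongrightarrow> 2 * D"
      unfolding f_def D_def
      by (rule \<mu>.radial_limit_norm_deriv_singular_inner[OF \<xi> atom int r(1,3) r_lim])
    have "(\<lambda>n. ln (max 1 (norm (f (of_real (r n) * \<xi>))))) \<longlonglongrightarrow> ln (max 1 (2 * D))"
      by (intro tendsto_ln tendsto_max tendsto_const lim) auto
    then have "(\<lambda>n. ennreal (log_plus (norm (f (of_real (r n) * \<xi>))))) \<longlonglongrightarrow> ennreal (log_plus (2 * D))"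
      using D0 by (intro tendsto_ennrealI) (simp add: log_plus_eq_ln_max)
    then have \<phi>: "\<phi> \<xi> = ennreal (log_plus (2 * D))"
      unfolding \<phi>_def by (intro lim_imp_Liminf) auto
    show ?case
    proof (intro allI impI)
      fix Q and d :: real assume Q: "Q \<in> sets \<mu>" "0 < d" "\<forall>\<zeta>\<in>Q. dist \<zeta> \<xi> \<le> d"
      then have "measure \<mu> Q / d\<^sup>2 \<le> D"
        unfolding D_def using \<mu>.measure_le_dist_sq[OF atom int Q(1,2) _ \<xi>] by blast
      then show "ennreal (log_plus (2 * (measure \<mu> Q / d\<^sup>2))) \<le> \<phi> \<xi>"
        unfolding \<phi> by (intro ennreal_leI log_plus_mono) auto
    qed
  qed
  moreover have "\<phi> \<in> borel_measurable circle_lebesgue"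
    unfolding \<phi>_def[abs_def] using m by measurable
  moreover have "(\<integral>\<^sup>+\<xi>. \<phi> \<xi> \<partial>circle_lebesgue) \<le> ennreal M"
  proof -
    have "(\<integral>\<^sup>+\<xi>. \<phi> \<xi> \<partial>circle_lebesgue)
        \<le> liminf (\<lambda>n. \<integral>\<^sup>+\<xi>. ennreal (log_plus (norm (f (of_real (r n) * \<xi>)))) \<partial>circle_lebesgue)"
      unfolding \<phi>_def by (rule nn_integral_liminf) (rule m)
    also have "\<dots> \<le> liminf (\<lambda>n::nat. ennreal M)"
    proof (rule Liminf_mono, rule always_eventually, rule allI)
      fix n
      have "(\<integral>\<^sup>+\<xi>. ennreal (log_plus (norm (f (of_real (r n) * \<xi>)))) \<partial>circle_lebesgue)
        = ennreal (\<integral>\<xi>. log_plus (norm (f (of_real (r n) * \<xi>))) \<partial>circle_lebesgue)"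
        by (rule nn_integral_eq_integral[OF integrable_circle_lebesgue[OF c]]) (simp add: log_plus_nonneg)
      also have "\<dots> \<le> ennreal M" by (intro ennreal_leI mean r)
      finally show "(\<integral>\<^sup>+\<xi>. ennreal (log_plus (norm (f (of_real (r n) * \<xi>)))) \<partial>circle_lebesgue) \<le> ennreal M" .
    qed
    also have "\<dots> = ennreal M" by (rule Liminf_const) simp
    finally show ?thesis .
  qed
  ultimately show ?thesis using that[of \<phi>] by (simp add: le_less_trans)
qed

section \<open>Dyadic arcs\<close>

lemma circle_eq_cis_image: "unit_circle = cis ` {0..<2 * pi}"
proof
  show "unit_circle \<subseteq> cis ` {0..<2 * pi}"
  proof
    fix \<xi> :: complex assume "\<xi> \<in> unit_circle"
    then have "norm \<xi> = 1" by simp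
    then obtain t where "0 \<le> t" "t < 2 * pi" "\<xi> = Complex (cos t) (sin t)"
      by (rule complex_unimodular_polar)
    then show "\<xi> \<in> cis ` {0..<2 * pi}" by (auto simp: complex_eq_iff intro!: image_eqI[of _ _ t])
  qed
qed auto

lemma inj_on_cis: "inj_on cis {0..<2 * pi}"
proof (rule inj_on_inverseI[where g=Arg2pi])
  fix t :: real assume "t \<in> {0..<2 * pi}"
  then show "Arg2pi (cis t) = t"
    by (intro Arg2pi_unique[of 1]) (auto simp: cis_conv_exp)
qed

lemma continuous_on_cis: "continuous_on A cis"
  unfolding cis_conv_exp[abs_def] by (intro continuous_intros)

lemma circle_minus_open_arc:
  assumes "0 \<le> a" "b \<le> 2 * pi"
  shows "unit_circle - cis ` {a<..<b} = cis ` ({0..2 * pi} - {a<..<b})"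
proof (rule set_eqI, rule iffI)
  fix \<xi> assume \<xi>: "\<xi> \<in> unit_circle - cis ` {a<..<b}"
  then obtain t where "t \<in> {0..<2 * pi}" "\<xi> = cis t" unfolding circle_eq_cis_image by auto
  then show "\<xi> \<in> cis ` ({0..2 * pi} - {a<..<b})" using \<xi> by force
next
  fix \<xi> assume "\<xi> \<in> cis ` ({0..2 * pi} - {a<..<b})"
  then obtain t where t: "\<xi> = cis t" "0 \<le> t" "t \<le> 2 * pi" "t \<le> a \<or> b \<le> t" by auto
  have "\<xi> \<noteq> cis s" if s: "s \<in> {a<..<b}" for s
  proof
    assume eq: "\<xi> = cis s"
    define t' where "t' = (if t = 2 * pi then 0 else t)"
    have "cis t' = cis s" using eq t by (auto simp: t'_def)
    moreover have "t' \<in> {0..<2 * pi}" "s \<in> {0..<2 * pi}" using t s assms by (auto simp: t'_def)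
    ultimately have "t' = s" using inj_on_cis by (auto dest: inj_onD)
    then show False using t s assms by (auto simp: t'_def split: if_splits)
  qed
  then have "\<xi> \<notin> cis ` {a<..<b}" by blast
  then show "\<xi> \<in> unit_circle - cis ` {a<..<b}" using t(1) by simp
qed

lemma closed_circle_minus_open_arc:
  assumes "0 \<le> a" "b \<le> 2 * pi" shows "closed (unit_circle - cis ` {a<..<b})"
  unfolding circle_minus_open_arc[OF assms]
  by (intro compact_imp_closed compact_continuous_image continuous_on_cis compact_diff) auto

lemma open_arc_sets:
  assumes "0 \<le> a" "b \<le> 2 * pi" shows "cis ` {a<..<b} \<in> sets circle_borel"
proof -
  have "cis ` {a<..<b} = unit_circle \<inter> - (unit_circle - cis ` {a<..<b})" by auto
  then show ?thesis
    using circle_inter_sets[OF open_Compl[OF closed_circle_minus_open_arc[OF assms]]] by argo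
qed

lemma half_open_arc_sets:
  assumes "0 \<le> a" "b \<le> 2 * pi" shows "cis ` {a..<b} \<in> sets circle_borel"
proof (cases "a < b")
  case True
  then have "{a..<b} = insert a {a<..<b}" by auto
  then have "cis ` {a..<b} = insert (cis a) (cis ` {a<..<b})" by simp
  moreover have "{cis a} \<in> sets circle_borel"
    by (simp add: singleton_circle_sets)
  ultimately show ?thesis using open_arc_sets[OF assms] by (metis insert_is_Un sets.Un)
qed simp

lemma emeasure_circle_lebesgue_arc:
  assumes "0 \<le> a" "a \<le> b" "b \<le> 2 * pi"
  shows "emeasure circle_lebesgue (cis ` {a<..<b}) = ennreal (b - a)"
    and "emeasure circle_lebesgue (cis ` {a..<b}) = ennreal (b - a)"
proof -
  have restr: "emeasure (restrict_space lborel {0..<2*pi}) A = emeasure lborel A" if "A \<subseteq> {0..<2*pi}" for A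
    using that by (intro emeasure_restrict_space) auto
  have sub: "{a<..<b} \<subseteq> {0..<2*pi}" "{a..<b} \<subseteq> {0..<2*pi}" using assms by auto
  have "cis -` (cis ` {a<..<b}) \<inter> {0..<2*pi} = {a<..<b}"
    using sub(1) inj_on_cis by (auto dest: inj_onD)
  then show "emeasure circle_lebesgue (cis ` {a<..<b}) = ennreal (b - a)"
    unfolding circle_lebesgue_def using open_arc_sets[of a b] assms
    by (subst emeasure_distr) (auto simp: space_restrict_space restr[OF sub(1)])
  have "cis -` (cis ` {a..<b}) \<inter> {0..<2*pi} = {a..<b}"
    using sub(2) inj_on_cis by (auto dest: inj_onD)
  then show "emeasure circle_lebesgue (cis ` {a..<b}) = ennreal (b - a)"
    unfolding circle_lebesgue_def using half_open_arc_sets[of a b] assms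
    by (subst emeasure_distr) (auto simp: space_restrict_space restr[OF sub(2)])
qed

lemma dist_cis_le: "dist (cis a) (cis b) \<le> \<bar>a - b\<bar>"
proof -
  have "norm (exp (\<i> * of_real a) - exp (\<i> * of_real b)) \<le> 1 * norm (\<i> * of_real a - \<i> * of_real b)"
  proof (rule field_differentiable_bound[where S="{z. Re z \<le> 0}" and f'=exp])
    fix z :: complex
    show "(exp has_field_derivative exp z) (at z within {z. Re z \<le> 0})" by (rule DERIV_exp[THEN has_field_derivative_at_within])
  qed (auto simp: convex_halfspace_Re_le)
  also have "\<i> * of_real a - \<i> * of_real b = \<i> * of_real (a - b)" by (simp add: algebra_simps)
  finally have "norm (cis a - cis b) \<le> \<bar>a - b\<bar>" by (simp add: cis_conv_exp norm_mult del: of_real_diff)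
  then show ?thesis by (simp add: dist_norm)
qed

text \<open>
  The arcs are half-open, so that those of one generation form a partition of the circle.
\<close>
definition dyadic_arc :: "nat \<Rightarrow> nat \<Rightarrow> complex set" where
  "dyadic_arc n j = cis ` {2 * pi * (real j / 2 ^ n)..<2 * pi * ((real j + 1) / 2 ^ n)}"

definition open_dyadic_arc :: "nat \<Rightarrow> nat \<Rightarrow> complex set" where
  "open_dyadic_arc n j = cis ` {2 * pi * (real j / 2 ^ n)<..<2 * pi * ((real j + 1) / 2 ^ n)}"

text \<open>
  The number of the dyadic arc of generation n that contains the point with argument \<theta>.
  Passing to the parent arc is integer division by 2, see dyadic_index_div.
\<close>
definition dyadic_index :: "nat \<Rightarrow> real \<Rightarrow> nat" where
  "dyadic_index n \<theta> = nat \<lfloor>\<theta> / (2 * pi) * 2 ^ n\<rfloor>"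

lemma dyadic_index_eq_iff:
  assumes "0 \<le> \<theta>"
  shows "dyadic_index n \<theta> = j \<longleftrightarrow> 2 * pi * (real j / 2 ^ n) \<le> \<theta> \<and> \<theta> < 2 * pi * ((real j + 1) / 2 ^ n)"
proof -
  have "dyadic_index n \<theta> = j \<longleftrightarrow> \<lfloor>\<theta> / (2 * pi) * 2 ^ n\<rfloor> = int j"
    using assms by (auto simp: dyadic_index_def)
  also have "\<dots> \<longleftrightarrow> real j \<le> \<theta> / (2 * pi) * 2 ^ n \<and> \<theta> / (2 * pi) * 2 ^ n < real j + 1"
    by (simp add: floor_eq_iff)
  also have "\<dots> \<longleftrightarrow> 2 * pi * (real j / 2 ^ n) \<le> \<theta> \<and> \<theta> < 2 * pi * ((real j + 1) / 2 ^ n)"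
    by (simp add: field_simps)
  finally show ?thesis .
qed

lemma dyadic_bounds:
  assumes "j < 2 ^ n"
  shows "0 \<le> 2 * pi * (real j / 2 ^ n)" "2 * pi * ((real j + 1) / 2 ^ n) \<le> 2 * pi"
    "2 * pi * (real j / 2 ^ n) < 2 * pi * ((real j + 1) / 2 ^ n)"
proof -
  have "real (Suc j) \<le> real (2 ^ n)" using assms by (intro of_nat_mono) simp
  then have "(real j + 1) / 2 ^ n \<le> 1" by (simp add: field_simps)
  then have "2 * pi * ((real j + 1) / 2 ^ n) \<le> 2 * pi * 1" by (intro mult_left_mono) auto
  then show "2 * pi * ((real j + 1) / 2 ^ n) \<le> 2 * pi" by simp
qed (auto simp: divide_strict_right_mono)

lemma dyadic_index_less:
  assumes "0 \<le> \<theta>" "\<theta> < 2 * pi" shows "dyadic_index n \<theta> < 2 ^ n"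
proof -
  have "\<theta> / (2 * pi) * 2 ^ n < 1 * 2 ^ n" using assms by (intro mult_strict_right_mono) auto
  then have "\<lfloor>\<theta> / (2 * pi) * 2 ^ n\<rfloor> < 2 ^ n" by (simp add: floor_less_iff)
  then show ?thesis using assms by (simp add: dyadic_index_def nat_less_iff)
qed

lemma cis_in_dyadic_arc_iff:
  assumes "0 \<le> \<theta>" "\<theta> < 2 * pi" "j < 2 ^ n"
  shows "cis \<theta> \<in> dyadic_arc n j \<longleftrightarrow> dyadic_index n \<theta> = j"
proof -
  have "{2 * pi * (real j / 2 ^ n)..<2 * pi * ((real j + 1) / 2 ^ n)} \<subseteq> {0..<2 * pi}"
    using dyadic_bounds[OF assms(3)] by (intro subsetI) (simp only: atLeastLessThan_iff, linarith)
  then show ?thesis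
    unfolding dyadic_arc_def dyadic_index_eq_iff[OF assms(1)]
    using assms by (subst inj_on_image_mem_iff[OF inj_on_cis]) auto
qed

lemma cis_in_open_dyadic_arc_iff:
  assumes "0 \<le> \<theta>" "\<theta> < 2 * pi" "j < 2 ^ n"
  shows "cis \<theta> \<in> open_dyadic_arc n j \<longleftrightarrow> dyadic_index n \<theta> = j \<and> \<theta> \<noteq> 2 * pi * (real j / 2 ^ n)"
proof -
  have "{2 * pi * (real j / 2 ^ n)<..<2 * pi * ((real j + 1) / 2 ^ n)} \<subseteq> {0..<2 * pi}"
    using dyadic_bounds[OF assms(3)]
    by (intro subsetI) (simp only: atLeastLessThan_iff greaterThanLessThan_iff, linarith)
  then show ?thesis
    unfolding open_dyadic_arc_def dyadic_index_eq_iff[OF assms(1)]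
    using assms by (subst inj_on_image_mem_iff[OF inj_on_cis]) auto
qed

lemma dyadic_index_div:
  assumes "m \<le> n" "0 \<le> \<theta>"
  shows "dyadic_index m \<theta> = dyadic_index n \<theta> div 2 ^ (n - m)"
proof -
  have "\<theta> / (2 * pi) * 2 ^ m = (\<theta> / (2 * pi) * 2 ^ n) / real_of_int (2 ^ (n - m))"
  proof -
    have "(2::real) ^ n = 2 ^ m * 2 ^ (n - m)" using assms(1) by (simp flip: power_add)
    then show ?thesis by simp
  qed
  then have "\<lfloor>\<theta> / (2 * pi) * 2 ^ m\<rfloor> = \<lfloor>\<theta> / (2 * pi) * 2 ^ n\<rfloor> div 2 ^ (n - m)"
    using floor_divide_real_eq_div[of "2 ^ (n - m)" "\<theta> / (2 * pi) * 2 ^ n"] by simp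
  then show ?thesis
    using assms(2) by (simp add: dyadic_index_def nat_div_distrib nat_power_eq)
qed

lemma open_dyadic_arc_subset: "open_dyadic_arc n j \<subseteq> dyadic_arc n j"
  unfolding open_dyadic_arc_def dyadic_arc_def by (intro image_mono) auto

lemma dyadic_arc_subset_circle: "dyadic_arc n j \<subseteq> unit_circle"
  by (auto simp: dyadic_arc_def)

lemma open_arc_dyadic: "j < 2 ^ n \<Longrightarrow> open_arc (open_dyadic_arc n j)"
  unfolding open_arc_def open_dyadic_arc_def
  by (rule exI[of _ "2 * pi * (real j / 2 ^ n)"], rule exI[of _ "2 * pi * ((real j + 1) / 2 ^ n)"])
     (intro conjI refl; use dyadic_bounds[of j n] in linarith)

lemma dyadic_arc_sets: "j < 2 ^ n \<Longrightarrow> dyadic_arc n j \<in> sets circle_borel"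
  unfolding dyadic_arc_def by (intro half_open_arc_sets dyadic_bounds)

lemma open_dyadic_arc_sets: "j < 2 ^ n \<Longrightarrow> open_dyadic_arc n j \<in> sets circle_borel"
  unfolding open_dyadic_arc_def by (intro open_arc_sets dyadic_bounds)

lemma dyadic_length: "2 * pi * ((real j + 1) / 2 ^ n) - 2 * pi * (real j / 2 ^ n) = 2 * pi / 2 ^ n"
  by (simp add: field_simps)

lemma emeasure_dyadic_arc:
  assumes "j < 2 ^ n" shows "emeasure circle_lebesgue (dyadic_arc n j) = ennreal (2 * pi / 2 ^ n)"
  unfolding dyadic_arc_def using dyadic_bounds[OF assms]
  by (subst emeasure_circle_lebesgue_arc) (auto simp only: dyadic_length less_imp_le)

lemma arc_length_dyadic:
  assumes "j < 2 ^ n" shows "arc_length (open_dyadic_arc n j) = 2 * pi / 2 ^ n"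
proof -
  have "emeasure circle_lebesgue (open_dyadic_arc n j) = ennreal (2 * pi / 2 ^ n)"
    unfolding open_dyadic_arc_def using dyadic_bounds[OF assms]
    by (subst emeasure_circle_lebesgue_arc) (auto simp only: dyadic_length less_imp_le)
  then show ?thesis by (simp add: arc_length_def measure_def)
qed

lemma dist_dyadic_arc:
  assumes "\<zeta> \<in> dyadic_arc n j" "\<xi> \<in> dyadic_arc n j" shows "dist \<zeta> \<xi> \<le> 2 * pi / 2 ^ n"
proof -
  obtain a b where ab: "\<zeta> = cis a" "\<xi> = cis b"
    and "a \<in> {2 * pi * (real j / 2 ^ n)..<2 * pi * ((real j + 1) / 2 ^ n)}"
        "b \<in> {2 * pi * (real j / 2 ^ n)..<2 * pi * ((real j + 1) / 2 ^ n)}"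
    using assms by (auto simp: dyadic_arc_def)
  then have "\<bar>a - b\<bar> \<le> 2 * pi / 2 ^ n" using dyadic_length[of j n] by auto
  then show ?thesis using dist_cis_le[of a b] ab by simp
qed

lemma singleton_null_circle_lebesgue:
  assumes \<xi>: "norm \<xi> = 1" shows "{\<xi>} \<in> null_sets circle_lebesgue"
proof -
  have s: "{\<xi>} \<in> sets circle_lebesgue"
    using singleton_circle_sets[OF \<xi>] by (simp add: sets_circle_lebesgue)
  have "measure circle_lebesgue {\<xi>} \<le> 8 * pi * (1 / real (Suc n))" for n
    using circle_lebesgue.finite_measure_mono[of "{\<xi>}" "unit_circle \<inter> ball \<xi> (1 / real (Suc n))"]
      measure_circle_lebesgue_ball[OF \<xi>, of "1 / real (Suc n)"] \<xi> by simp
  moreover have "(\<lambda>n. 8 * pi * (1 / real (Suc n))) \<longlonglongrightarrow> 0" by real_asymp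
  ultimately have "measure circle_lebesgue {\<xi>} \<le> 0" by (intro LIMSEQ_le_const[of _ 0]) auto
  then show ?thesis using s
    by (auto simp: null_sets_def circle_lebesgue.emeasure_eq_measure measure_le_0_iff)
qed

section \<open>The Beurling-Carleson sets carrying the measure\<close>

text \<open>
  Generation n has length 2 \<pi> / 2^n. Light arcs carry a summably small mass because 1/3 < 1/2, and the
  other arcs force D to grow geometrically in n because 1/3 > 1/4.
\<close>
definition light_arc :: "complex measure \<Rightarrow> nat \<Rightarrow> nat \<Rightarrow> bool" where
  "light_arc \<mu> n j \<longleftrightarrow> measure \<mu> (dyadic_arc n j) \<le> (1 / 3) ^ n"

text \<open>
  The maximal light arcs of generation at least k; the arc j of generation n lies in the arc
  j div 2^(n - m) of generation m.
\<close>
definition first_light :: "complex measure \<Rightarrow> nat \<Rightarrow> (nat \<times> nat) set" where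
  "first_light \<mu> k = {(n, j). k \<le> n \<and> j < 2 ^ n \<and> light_arc \<mu> n j \<and>
     (\<forall>m. k \<le> m \<longrightarrow> m < n \<longrightarrow> \<not> light_arc \<mu> m (j div 2 ^ (n - m)))}"

definition heavy_set :: "complex measure \<Rightarrow> nat \<Rightarrow> complex set" where
  "heavy_set \<mu> k = unit_circle - (\<Union>(n, j)\<in>first_light \<mu> k. open_dyadic_arc n j)"

lemma first_light_unique:
  assumes "(n, dyadic_index n \<theta>) \<in> first_light \<mu> k" "(m, dyadic_index m \<theta>) \<in> first_light \<mu> k" "0 \<le> \<theta>"
  shows "n = m"
proof -
  have "\<not> n < m" if "(n, dyadic_index n \<theta>) \<in> first_light \<mu> k" "(m, dyadic_index m \<theta>) \<in> first_light \<mu> k" for n m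
    using that assms(3) dyadic_index_div[of n m \<theta>] by (auto simp: first_light_def)
  from this[OF assms(1,2)] this[OF assms(2,1)] show ?thesis by simp
qed

lemma first_light_exists:
  assumes "light_arc \<mu> n (dyadic_index n \<theta>)" "k \<le> n" "0 \<le> \<theta>" "\<theta> < 2 * pi"
  obtains m where "(m, dyadic_index m \<theta>) \<in> first_light \<mu> k"
proof -
  define m where "m = (LEAST m. k \<le> m \<and> light_arc \<mu> m (dyadic_index m \<theta>))"
  have m: "k \<le> m" "light_arc \<mu> m (dyadic_index m \<theta>)"
    using LeastI[of "\<lambda>m. k \<le> m \<and> light_arc \<mu> m (dyadic_index m \<theta>)" n] assms by (auto simp: m_def)
  have "\<not> light_arc \<mu> i (dyadic_index m \<theta> div 2 ^ (m - i))" if "k \<le> i" "i < m" for i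
    using not_less_Least[of i "\<lambda>m. k \<le> m \<and> light_arc \<mu> m (dyadic_index m \<theta>)"] that
      dyadic_index_div[of i m \<theta>] assms(3) by (auto simp: m_def)
  then show ?thesis
    using m dyadic_index_less[OF assms(3,4)] by (intro that[of m]) (auto simp: first_light_def)
qed

lemma circle_point_cases:
  assumes "norm \<xi> = 1" obtains \<theta> where "0 \<le> \<theta>" "\<theta> < 2 * pi" "\<xi> = cis \<theta>"
proof -
  have "\<xi> \<in> unit_circle" using assms by simp
  then show ?thesis unfolding circle_eq_cis_image using that by auto
qed

lemma disjoint_first_light:
  "disjoint_family_on (\<lambda>(n, j). dyadic_arc n j) (first_light \<mu> k)"
  unfolding disjoint_family_on_def
proof (intro ballI impI, rule ccontr)
  fix p q assume pq: "p \<in> first_light \<mu> k" "q \<in> first_light \<mu> k" "p \<noteq> q"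
    and ne: "(case p of (n, j) \<Rightarrow> dyadic_arc n j) \<inter> (case q of (n, j) \<Rightarrow> dyadic_arc n j) \<noteq> {}"
  obtain n j m i where p: "p = (n, j)" and q: "q = (m, i)" by (cases p, cases q) auto
  obtain \<xi> where \<xi>: "\<xi> \<in> dyadic_arc n j" "\<xi> \<in> dyadic_arc m i" using ne by (auto simp: p q)
  then have "norm \<xi> = 1" using dyadic_arc_subset_circle by fastforce
  then obtain \<theta> where \<theta>: "0 \<le> \<theta>" "\<theta> < 2 * pi" "\<xi> = cis \<theta>" by (rule circle_point_cases)
  have "j < 2 ^ n" "i < 2 ^ m" using pq by (auto simp: first_light_def p q)
  then have "dyadic_index n \<theta> = j" "dyadic_index m \<theta> = i"
    using \<xi> \<theta> cis_in_dyadic_arc_iff by auto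
  then show False using first_light_unique[of n \<theta> \<mu> k m] pq \<theta> by (auto simp: p q)
qed

lemma closed_heavy_set: "closed (heavy_set \<mu> k)"
proof -
  have "heavy_set \<mu> k = unit_circle \<inter> (\<Inter>(n, j)\<in>first_light \<mu> k. unit_circle - open_dyadic_arc n j)"
    by (auto simp: heavy_set_def)
  also have "closed \<dots>"
    unfolding open_dyadic_arc_def
    by (intro closed_Int closed_INT ballI)
       (auto simp: first_light_def simp del: times_divide_eq_right
         intro!: closed_circle_minus_open_arc dyadic_bounds)
  finally show ?thesis .
qed

lemma ln_two_pi_sq_nonneg: "0 \<le> ln (2 * pi\<^sup>2)"
proof -
  have "1 \<le> pi\<^sup>2" using pi_ge_two by (simp add: one_le_power)
  then show ?thesis by simp
qed

context
  fixes \<mu> :: "complex measure" and \<phi> :: "complex \<Rightarrow> ennreal"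
  assumes \<mu>: "circle_measure \<mu>"
    and \<phi>_meas: "\<phi> \<in> borel_measurable circle_lebesgue"
    and \<phi>_fin: "(\<integral>\<^sup>+\<xi>. \<phi> \<xi> \<partial>circle_lebesgue) < \<infinity>"
    and \<phi>_ge: "AE \<xi> in circle_lebesgue. \<forall>Q d. Q \<in> sets \<mu> \<longrightarrow> 0 < d \<longrightarrow> (\<forall>\<zeta>\<in>Q. dist \<zeta> \<xi> \<le> d) \<longrightarrow>
        ennreal (log_plus (2 * (measure \<mu> Q / d\<^sup>2))) \<le> \<phi> \<xi>"
begin

interpretation \<mu>: circle_measure \<mu> by (rule \<mu>)

text \<open>
  A set of mass at least 3^(-m) and diameter at most 2 \<pi> / 2^m gives 2 D \<ge> (4/3)^m / (2 \<pi>^2) at each of its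
  points.
\<close>
lemma heavy_arc_bound:
  "AE \<xi> in circle_lebesgue. \<forall>m i. i < 2 ^ m \<longrightarrow> \<xi> \<in> dyadic_arc m i \<longrightarrow> \<not> light_arc \<mu> m i \<longrightarrow>
     ennreal (real m * ln (4 / 3)) \<le> \<phi> \<xi> + ennreal (ln (2 * pi\<^sup>2))"
  using \<phi>_ge
proof eventually_elim
  case (elim \<xi>)
  show ?case
  proof (intro allI impI)
    fix m i :: nat assume i: "i < 2 ^ m" and \<xi>: "\<xi> \<in> dyadic_arc m i" and heavy: "\<not> light_arc \<mu> m i"
    define d where "d = 2 * pi / 2 ^ m"
    have d: "0 < d" by (simp add: d_def)
    define x where "x = 2 * (measure \<mu> (dyadic_arc m i) / d\<^sup>2)"
    have le: "ennreal (log_plus x) \<le> \<phi> \<xi>"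
      unfolding x_def using elim i d \<xi> dist_dyadic_arc[of _ m i \<xi>] dyadic_arc_sets[OF i]
      by (auto simp: \<mu>.sets_circle d_def)
    have "(4 / 3) ^ m / (2 * pi\<^sup>2) = 2 * ((1 / 3) ^ m / d\<^sup>2)"
    proof -
      have "((2::real) ^ m)\<^sup>2 = (2\<^sup>2) ^ m" by (simp only: power_mult[symmetric] mult.commute)
      then have "d\<^sup>2 = 4 * pi\<^sup>2 / 4 ^ m" by (simp add: d_def power_divide power_mult_distrib)
      then show ?thesis by (simp add: power_divide)
    qed
    also have "\<dots> \<le> x"
      unfolding x_def using heavy d by (intro mult_left_mono divide_right_mono) (auto simp: light_arc_def)
    finally have x: "(4 / 3) ^ m / (2 * pi\<^sup>2) \<le> x" .
    have pos: "0 < (4 / 3) ^ m / (2 * pi\<^sup>2)" by simp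
    have "real m * ln (4 / 3) - ln (2 * pi\<^sup>2) = ln ((4 / 3) ^ m / (2 * pi\<^sup>2))"
      by (simp add: ln_div ln_realpow)
    also have "\<dots> \<le> ln x" using x less_le_trans[OF pos x] by (subst ln_le_cancel_iff) auto
    also have "\<dots> \<le> log_plus x" by (simp add: log_plus_def)
    finally have "real m * ln (4 / 3) \<le> log_plus x + ln (2 * pi\<^sup>2)" by simp
    then have "ennreal (real m * ln (4 / 3)) \<le> ennreal (log_plus x + ln (2 * pi\<^sup>2))"
      by (rule ennreal_leI)
    also have "\<dots> = ennreal (log_plus x) + ennreal (ln (2 * pi\<^sup>2))"
      by (rule ennreal_plus[OF log_plus_nonneg ln_two_pi_sq_nonneg])
    also have "\<dots> \<le> \<phi> \<xi> + ennreal (ln (2 * pi\<^sup>2))" using le by (rule add_right_mono)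
    finally show "ennreal (real m * ln (4 / 3)) \<le> \<phi> \<xi> + ennreal (ln (2 * pi\<^sup>2))" .
  qed
qed

text \<open>
  The entropy estimate. On a maximal light arc of generation n > k the bound for its parent gives
  (n + 1) ln (4/3) \<le> \<phi> + B almost everywhere; for n = k this holds by the choice of B. Integrate over
  the disjoint arcs.
\<close>
lemma summable_first_light: "(\<lambda>(n, j). real (n + 1) / 2 ^ n) summable_on first_light \<mu> k"
proof -
  define c :: real where "c = ln (4 / 3)"
  have c: "0 < c" by (simp add: c_def)
  note L = ln_two_pi_sq_nonneg
  define B where "B = real (k + 2) * c + ln (2 * pi\<^sup>2)"
  define \<psi> where "\<psi> \<xi> = \<phi> \<xi> + ennreal B" for \<xi>
  have \<psi>m: "\<psi> \<in> borel_measurable circle_lebesgue" unfolding \<psi>_def[abs_def] using \<phi>_meas by measurable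
  define N where "N = density circle_lebesgue \<psi>"
  have "(\<integral>\<^sup>+\<xi>. \<psi> \<xi> \<partial>circle_lebesgue) = (\<integral>\<^sup>+\<xi>. \<phi> \<xi> \<partial>circle_lebesgue) + ennreal B * ennreal (2 * pi)"
    unfolding \<psi>_def using \<phi>_meas
    by (subst nn_integral_add) (auto simp: emeasure_circle_lebesgue_space)
  also have "\<dots> < \<infinity>" using \<phi>_fin by (simp add: ennreal_mult_less_top)
  finally have N_fin: "(\<integral>\<^sup>+\<xi>. \<psi> \<xi> \<partial>circle_lebesgue) < \<infinity>" .
  define K where "K = enn2real (\<integral>\<^sup>+\<xi>. \<psi> \<xi> \<partial>circle_lebesgue)"
  have sets_arc: "(case p of (n, j) \<Rightarrow> dyadic_arc n j) \<in> sets circle_lebesgue" if "p \<in> first_light \<mu> k" for p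
    using that dyadic_arc_sets by (auto simp: first_light_def sets_circle_lebesgue)
  have AEb: "AE \<xi> in circle_lebesgue. \<forall>(n, j)\<in>first_light \<mu> k. \<xi> \<in> dyadic_arc n j \<longrightarrow>
      ennreal (real (n + 1) * c) \<le> \<psi> \<xi>"
    using heavy_arc_bound
  proof eventually_elim
    case (elim \<xi>)
    show ?case
    proof (intro ballI, clarify)
      fix n j assume nj: "(n, j) \<in> first_light \<mu> k" and \<xi>: "\<xi> \<in> dyadic_arc n j"
      have n: "k \<le> n" "j < 2 ^ n" using nj by (auto simp: first_light_def)
      show "ennreal (real (n + 1) * c) \<le> \<psi> \<xi>"
      proof (cases "n = k")
        case True
        have "real (n + 1) * c \<le> B" using True c L by (simp add: B_def algebra_simps)
        then have "ennreal (real (n + 1) * c) \<le> 0 + ennreal B" by (simp add: ennreal_leI)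
        also have "\<dots> \<le> \<psi> \<xi>" unfolding \<psi>_def by (rule add_right_mono) simp
        finally show ?thesis .
      next
        case False
        then obtain m where m: "n = Suc m" "k \<le> m" using n by (cases n) auto
        have heavy: "\<not> light_arc \<mu> m (j div 2)"
        proof -
          have "\<forall>m. k \<le> m \<longrightarrow> m < n \<longrightarrow> \<not> light_arc \<mu> m (j div 2 ^ (n - m))"
            using nj by (simp add: first_light_def)
          from this[rule_format, of m] show ?thesis using m by simp
        qed
        have jm: "j div 2 < 2 ^ m" using n m by (simp add: less_mult_imp_div_less)
        have "\<xi> \<in> dyadic_arc m (j div 2)"
        proof -
          have "norm \<xi> = 1" using \<xi> dyadic_arc_subset_circle by fastforce
          then obtain \<theta> where \<theta>: "0 \<le> \<theta>" "\<theta> < 2 * pi" "\<xi> = cis \<theta>" by (rule circle_point_cases)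
          then have "dyadic_index n \<theta> = j" using cis_in_dyadic_arc_iff \<xi> n by auto
          then have "dyadic_index m \<theta> = j div 2" using dyadic_index_div[of m n \<theta>] m \<theta> by simp
          then show ?thesis using cis_in_dyadic_arc_iff[OF \<theta>(1,2) jm] \<theta> by simp
        qed
        then have *: "ennreal (real m * c) \<le> \<phi> \<xi> + ennreal (ln (2 * pi\<^sup>2))"
          using elim jm heavy by (auto simp: c_def)
        have "ennreal (real (n + 1) * c) = ennreal (real m * c) + ennreal (2 * c)"
          using c m by (simp add: algebra_simps flip: ennreal_plus)
        also have "\<dots> \<le> \<phi> \<xi> + ennreal (ln (2 * pi\<^sup>2)) + ennreal (2 * c)"
          using * by (rule add_right_mono)
        also have "\<dots> = \<phi> \<xi> + ennreal (ln (2 * pi\<^sup>2) + 2 * c)"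
          using L c by (simp add: add.assoc ennreal_plus)
        also have "\<dots> \<le> \<psi> \<xi>"
          unfolding \<psi>_def B_def using c by (intro add_left_mono ennreal_leI) (simp add: algebra_simps)
        finally show ?thesis .
      qed
    qed
  qed
  have arc_le: "ennreal (real (n + 1) / 2 ^ n * (2 * pi * c)) \<le> emeasure N (dyadic_arc n j)"
    if nj: "(n, j) \<in> first_light \<mu> k" for n j
  proof -
    have jn: "j < 2 ^ n" using nj by (auto simp: first_light_def)
    have s: "dyadic_arc n j \<in> sets circle_lebesgue" using sets_arc[OF nj] by simp
    have "ennreal (real (n + 1) / 2 ^ n * (2 * pi * c)) = ennreal (real (n + 1) * c) * ennreal (2 * pi / 2 ^ n)"
      using c by (simp flip: ennreal_mult add: mult_ac)
    also have "\<dots> = (\<integral>\<^sup>+\<xi>. ennreal (real (n + 1) * c) * indicator (dyadic_arc n j) \<xi> \<partial>circle_lebesgue)"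
      using s by (simp add: nn_integral_cmult_indicator emeasure_dyadic_arc[OF jn])
    also have "\<dots> \<le> (\<integral>\<^sup>+\<xi>. \<psi> \<xi> * indicator (dyadic_arc n j) \<xi> \<partial>circle_lebesgue)"
    proof (rule nn_integral_mono_AE)
      show "AE \<xi> in circle_lebesgue. ennreal (real (n + 1) * c) * indicator (dyadic_arc n j) \<xi>
         \<le> \<psi> \<xi> * indicator (dyadic_arc n j) \<xi>"
        using AEb by eventually_elim (use nj in \<open>auto split: split_indicator\<close>)
    qed
    also have "\<dots> = emeasure N (dyadic_arc n j)"
      unfolding N_def using s \<psi>m by (simp add: emeasure_density)
    finally show ?thesis .
  qed
  have bound: "(\<Sum>(n, j)\<in>F. real (n + 1) / 2 ^ n) \<le> K / (2 * pi * c)"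
    if F: "finite F" "F \<subseteq> first_light \<mu> k" for F
  proof -
    have "ennreal ((\<Sum>(n, j)\<in>F. real (n + 1) / 2 ^ n) * (2 * pi * c))
        = (\<Sum>(n, j)\<in>F. ennreal (real (n + 1) / 2 ^ n * (2 * pi * c)))"
      using c by (subst sum_distrib_right, subst sum_ennreal[symmetric]) (auto simp: case_prod_beta)
    also have "\<dots> \<le> (\<Sum>p\<in>F. emeasure N (case p of (n, j) \<Rightarrow> dyadic_arc n j))"
      using arc_le F by (intro sum_mono) auto
    also have "\<dots> = emeasure N (\<Union>p\<in>F. case p of (n, j) \<Rightarrow> dyadic_arc n j)"
    proof (rule sum_emeasure)
      show "(\<lambda>p. case p of (n, j) \<Rightarrow> dyadic_arc n j) ` F \<subseteq> sets N"
        using sets_arc F by (auto simp: N_def)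
      show "disjoint_family_on (\<lambda>p. case p of (n, j) \<Rightarrow> dyadic_arc n j) F"
        using disjoint_first_light F(2) by (rule disjoint_family_on_mono[rotated])
    qed (rule F)
    also have "\<dots> \<le> emeasure N (space N)" by (rule emeasure_space)
    also have "\<dots> = (\<integral>\<^sup>+\<xi>. \<psi> \<xi> \<partial>circle_lebesgue)"
      unfolding N_def space_density
      by (subst emeasure_density[OF \<psi>m sets.top]) (rule nn_integral_cong, simp)
    also have "\<dots> = ennreal K" using N_fin by (simp add: K_def)
    finally have "(\<Sum>(n, j)\<in>F. real (n + 1) / 2 ^ n) * (2 * pi * c) \<le> K"
      by (subst (asm) ennreal_le_iff) (simp_all add: K_def)
    then show ?thesis using c by (simp add: field_simps)
  qed
  show ?thesis
  proof (rule nonneg_bdd_above_summable_on)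
    show "bdd_above (sum (\<lambda>(n, j). real (n + 1) / 2 ^ n) ` {F. F \<subseteq> first_light \<mu> k \<and> finite F})"
      by (rule bdd_aboveI2, rule bound) auto
  qed auto
qed

text \<open>
  A point of the set that is not a dyadic endpoint lies in no light arc of generation at least k, so
  the lower bound for \<phi> along these arcs makes \<phi> infinite there.
\<close>
lemma heavy_set_null: "heavy_set \<mu> k \<in> null_sets circle_lebesgue"
proof -
  have Es: "heavy_set \<mu> k \<in> sets circle_lebesgue"
    using closed_heavy_set[of \<mu> k]
    by (auto simp: sets_circle_lebesgue sets_restrict_space image_iff heavy_set_def
      intro!: bexI[of _ "heavy_set \<mu> k"])
  define Dy where "Dy = (\<Union>n j. {cis (2 * pi * (real j / 2 ^ n))})"
  have "Dy \<in> null_sets circle_lebesgue"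
    unfolding Dy_def by (intro null_sets_UN) (simp add: singleton_null_circle_lebesgue)
  then have notDy: "AE \<xi> in circle_lebesgue. \<xi> \<notin> Dy" by (rule AE_not_in)
  have \<phi>_fin_AE: "AE \<xi> in circle_lebesgue. \<phi> \<xi> \<noteq> \<infinity>"
    using \<phi>_fin \<phi>_meas by (intro nn_integral_noteq_infinite) auto
  have "AE \<xi> in circle_lebesgue. \<xi> \<notin> heavy_set \<mu> k"
    using heavy_arc_bound notDy \<phi>_fin_AE AE_space
  proof eventually_elim
    case (elim \<xi>)
    show ?case
    proof
      assume h: "\<xi> \<in> heavy_set \<mu> k"
      then have "norm \<xi> = 1" by (simp add: heavy_set_def)
      then obtain \<theta> where \<theta>: "0 \<le> \<theta>" "\<theta> < 2 * pi" "\<xi> = cis \<theta>" by (rule circle_point_cases)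
      \<comment> \<open>otherwise a maximal light arc contains \<xi>, and in its interior as \<xi> is no endpoint\<close>
      have heavy: "\<not> light_arc \<mu> n (dyadic_index n \<theta>)" if n: "k \<le> n" for n
      proof
        assume "light_arc \<mu> n (dyadic_index n \<theta>)"
        then obtain m where m: "(m, dyadic_index m \<theta>) \<in> first_light \<mu> k"
          using first_light_exists n \<theta> by blast
        have "cis (2 * pi * (real (dyadic_index m \<theta>) / 2 ^ m)) \<in> Dy" unfolding Dy_def by blast
        then have "\<theta> \<noteq> 2 * pi * (real (dyadic_index m \<theta>) / 2 ^ m)" using elim(2) \<theta>(3) by metis
        then have "\<xi> \<in> open_dyadic_arc m (dyadic_index m \<theta>)"
          using cis_in_open_dyadic_arc_iff[OF \<theta>(1,2) dyadic_index_less[OF \<theta>(1,2)]] \<theta>(3) by blast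
        then show False using h m by (auto simp: heavy_set_def)
      qed
      obtain y where y: "\<phi> \<xi> = ennreal y" "0 \<le> y" using elim(3) by (cases "\<phi> \<xi>") auto
      note L = ln_two_pi_sq_nonneg
      have "real n * ln (4 / 3) \<le> y + ln (2 * pi\<^sup>2)" if n: "k \<le> n" for n
      proof -
        have "\<xi> \<in> dyadic_arc n (dyadic_index n \<theta>)"
          using cis_in_dyadic_arc_iff[OF \<theta>(1,2) dyadic_index_less[OF \<theta>(1,2)]] \<theta>(3) by simp
        then have "ennreal (real n * ln (4 / 3)) \<le> \<phi> \<xi> + ennreal (ln (2 * pi\<^sup>2))"
          using elim(1) dyadic_index_less[OF \<theta>(1,2)] heavy[OF n] by blast
        then show ?thesis using y L by (simp flip: ennreal_plus)
      qed
      moreover obtain n where "(y + ln (2 * pi\<^sup>2)) / ln (4 / 3) < real n" using reals_Archimedean2 by blast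
      ultimately have "real (max n k) * ln (4 / 3) \<le> y + ln (2 * pi\<^sup>2)"
        "y + ln (2 * pi\<^sup>2) < real n * ln (4 / 3)" by (auto simp: field_simps)
      moreover have "real n * ln (4 / 3) \<le> real (max n k) * ln (4 / 3)" by (intro mult_right_mono) auto
      ultimately show False by linarith
    qed
  qed
  then show ?thesis using Es by (simp add: AE_iff_null_sets)
qed

lemma beurling_carleson_heavy_set: "beurling_carleson (heavy_set \<mu> k)"
proof -
  define \<I> where "\<I> = (\<lambda>(n, j). open_dyadic_arc n j) ` first_light \<mu> k"
  have arc: "\<exists>n j. (n, j) \<in> first_light \<mu> k \<and> j < 2 ^ n \<and> I = open_dyadic_arc n j" if "I \<in> \<I>" for I
    using that by (auto simp: \<I>_def first_light_def)
  have disj: "open_dyadic_arc n j \<inter> open_dyadic_arc m i = {}"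
    if "(n, j) \<in> first_light \<mu> k" "(m, i) \<in> first_light \<mu> k" "(n, j) \<noteq> (m, i)" for n j m i
  proof -
    have "dyadic_arc n j \<inter> dyadic_arc m i = {}"
      using disjoint_family_onD[OF disjoint_first_light that] by simp
    then show ?thesis using open_dyadic_arc_subset by fastforce
  qed
  have ne: "open_dyadic_arc n j \<noteq> {}" if "j < 2 ^ n" for n j
    using dyadic_bounds(3)[OF that] unfolding open_dyadic_arc_def by (simp only: image_is_empty greaterThanLessThan_empty_iff not_le)
  have inj: "inj_on (\<lambda>(n, j). open_dyadic_arc n j) (first_light \<mu> k)"
  proof (rule inj_onI)
    fix p q assume "p \<in> first_light \<mu> k" "q \<in> first_light \<mu> k"
      and "(case p of (n, j) \<Rightarrow> open_dyadic_arc n j) = (case q of (n, j) \<Rightarrow> open_dyadic_arc n j)"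
    then show "p = q"
      using disj[of "fst p" "snd p" "fst q" "snd q"] ne[of "snd p" "fst p"]
      by (cases p, cases q) (auto simp: first_light_def)
  qed
  define g where "g I = arc_length I * ln (1 / arc_length I)" for I
  have l2pi: "0 \<le> ln (2 * pi)" using pi_ge_two by simp
  have "(\<lambda>p. norm ((g \<circ> (\<lambda>(n, j). open_dyadic_arc n j)) p)) summable_on first_light \<mu> k"
  proof (rule Infinite_Sum.abs_summable_on_comparison_test')
    show "(\<lambda>p. 2 * pi * (1 + ln (2 * pi)) * (case p of (n, j) \<Rightarrow> real (n + 1) / 2 ^ n)) summable_on first_light \<mu> k"
      by (rule summable_on_cmult_right[OF summable_first_light])
    fix p assume "p \<in> first_light \<mu> k"
    then obtain n j where p: "p = (n, j)" and j: "j < 2 ^ n" by (auto simp: first_light_def)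
    have "g (open_dyadic_arc n j) = 2 * pi / 2 ^ n * (real n * ln 2 - ln (2 * pi))"
      by (simp add: g_def arc_length_dyadic[OF j] ln_div ln_realpow ln_mult)
    then have "norm (g (open_dyadic_arc n j)) = 2 * pi / 2 ^ n * \<bar>real n * ln 2 - ln (2 * pi)\<bar>"
      by (simp add: abs_mult)
    also have "\<dots> \<le> 2 * pi / 2 ^ n * (real (n + 1) * (1 + ln (2 * pi)))"
    proof (rule mult_left_mono)
      have "real n * ln 2 \<le> real n * 1" using ln_2_less_1 by (intro mult_left_mono) auto
      moreover have "0 \<le> real n * ln 2" "0 \<le> real n * ln (2 * pi)" using l2pi by auto
      moreover have "real (n + 1) * (1 + ln (2 * pi)) = real n + 1 + real n * ln (2 * pi) + ln (2 * pi)"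
        by (simp add: algebra_simps)
      ultimately show "\<bar>real n * ln 2 - ln (2 * pi)\<bar> \<le> real (n + 1) * (1 + ln (2 * pi))"
        using l2pi by linarith
    qed simp
    also have "\<dots> = 2 * pi * (1 + ln (2 * pi)) * (real (n + 1) / 2 ^ n)" by simp
    finally show "norm ((g \<circ> (\<lambda>(n, j). open_dyadic_arc n j)) p)
       \<le> 2 * pi * (1 + ln (2 * pi)) * (case p of (n, j) \<Rightarrow> real (n + 1) / 2 ^ n)" by (simp add: p)
  qed
  then have "(g \<circ> (\<lambda>(n, j). open_dyadic_arc n j)) summable_on first_light \<mu> k"
    by (rule abs_summable_summable)
  then have summ: "g summable_on \<I>"
    unfolding \<I>_def by (simp add: summable_on_reindex[OF inj])
  have disjI: "disjoint \<I>"
    unfolding disjoint_def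
  proof (intro ballI impI)
    fix I J assume IJ: "I \<in> \<I>" "J \<in> \<I>" "I \<noteq> J"
    obtain n j where I: "(n, j) \<in> first_light \<mu> k" "I = open_dyadic_arc n j" using arc[OF IJ(1)] by blast
    obtain m i where J: "(m, i) \<in> first_light \<mu> k" "J = open_dyadic_arc m i" using arc[OF IJ(2)] by blast
    show "I \<inter> J = {}" using disj[OF I(1) J(1)] I J IJ(3) by auto
  qed
  have "unit_circle - heavy_set \<mu> k = \<Union>\<I>"
    using open_dyadic_arc_subset dyadic_arc_subset_circle by (fastforce simp: heavy_set_def \<I>_def)
  moreover have "\<forall>I\<in>\<I>. open_arc I" using arc open_arc_dyadic by blast
  ultimately show ?thesis
    unfolding beurling_carleson_def
    using closed_heavy_set heavy_set_null disjI summ[unfolded g_def[abs_def]]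
    by (intro conjI exI[of _ \<I>]) (auto simp: heavy_set_def)
qed

end

text \<open>
  A light arc of generation n \<ge> k has mass at most 3^(-n) \<le> (2/3)^k 2^(-n), and the lengths of the
  disjoint arcs add up to at most 2 \<pi>.
\<close>
lemma measure_complement_heavy_set:
  assumes \<mu>: "circle_measure \<mu>"
  shows "emeasure \<mu> (unit_circle - heavy_set \<mu> k) \<le> ennreal ((2 / 3) ^ k)"
proof -
  interpret \<mu>: circle_measure \<mu> by fact
  have count: "countable (first_light \<mu> k)" by simp
  have sets: "(case p of (n, j) \<Rightarrow> open_dyadic_arc n j) \<in> sets circle_borel"
    "(case p of (n, j) \<Rightarrow> dyadic_arc n j) \<in> sets circle_borel" if "p \<in> first_light \<mu> k" for p
    using that dyadic_arc_sets open_dyadic_arc_sets by (auto simp: first_light_def)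
  have "emeasure \<mu> (unit_circle - heavy_set \<mu> k) \<le> emeasure \<mu> (\<Union>p\<in>first_light \<mu> k. case p of (n, j) \<Rightarrow> open_dyadic_arc n j)"
    using sets count by (intro emeasure_mono sets.countable_UN') (auto simp: heavy_set_def \<mu>.sets_circle)
  also have "\<dots> \<le> (\<integral>\<^sup>+p. emeasure \<mu> (case p of (n, j) \<Rightarrow> open_dyadic_arc n j) \<partial>count_space (first_light \<mu> k))"
    using sets count by (intro emeasure_UN_countable_le) (auto simp: \<mu>.sets_circle)
  also have "\<dots> \<le> (\<integral>\<^sup>+p. ennreal ((2 / 3) ^ k / (2 * pi)) * emeasure circle_lebesgue (case p of (n, j) \<Rightarrow> dyadic_arc n j)
      \<partial>count_space (first_light \<mu> k))"
  proof (rule nn_integral_mono)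
    fix p assume "p \<in> space (count_space (first_light \<mu> k))"
    then have pf: "p \<in> first_light \<mu> k" by simp
    then obtain n j where p: "p = (n, j)" and nj: "k \<le> n" "j < 2 ^ n" "light_arc \<mu> n j"
      by (auto simp: first_light_def)
    have "emeasure \<mu> (open_dyadic_arc n j) \<le> emeasure \<mu> (dyadic_arc n j)"
      using sets(2)[OF pf] by (intro emeasure_mono open_dyadic_arc_subset) (simp add: p \<mu>.sets_circle)
    also have "\<dots> \<le> ennreal ((1 / 3) ^ n)"
      using nj(3) by (simp add: \<mu>.emeasure_eq_measure light_arc_def ennreal_leI)
    also have "\<dots> \<le> ennreal ((2 / 3) ^ k / (2 * pi) * (2 * pi / 2 ^ n))"
    proof (rule ennreal_leI)
      have "(1 / 3 :: real) ^ n = (2 / 3) ^ n / 2 ^ n" by (simp add: power_divide)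
      also have "\<dots> \<le> (2 / 3) ^ k / 2 ^ n"
        using nj(1) by (intro divide_right_mono power_decreasing) auto
      finally show "(1 / 3 :: real) ^ n \<le> (2 / 3) ^ k / (2 * pi) * (2 * pi / 2 ^ n)" by simp
    qed
    also have "\<dots> = ennreal ((2 / 3) ^ k / (2 * pi)) * emeasure circle_lebesgue (dyadic_arc n j)"
      unfolding emeasure_dyadic_arc[OF nj(2)] by (rule ennreal_mult) auto
    finally show "emeasure \<mu> (case p of (n, j) \<Rightarrow> open_dyadic_arc n j)
      \<le> ennreal ((2 / 3) ^ k / (2 * pi)) * emeasure circle_lebesgue (case p of (n, j) \<Rightarrow> dyadic_arc n j)"
      by (simp add: p)
  qed
  also have "\<dots> = ennreal ((2 / 3) ^ k / (2 * pi)) *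
      (\<integral>\<^sup>+p. emeasure circle_lebesgue (case p of (n, j) \<Rightarrow> dyadic_arc n j) \<partial>count_space (first_light \<mu> k))"
    by (rule nn_integral_cmult) simp
  also have "(\<integral>\<^sup>+p. emeasure circle_lebesgue (case p of (n, j) \<Rightarrow> dyadic_arc n j) \<partial>count_space (first_light \<mu> k))
     = emeasure circle_lebesgue (\<Union>p\<in>first_light \<mu> k. case p of (n, j) \<Rightarrow> dyadic_arc n j)"
    using sets count disjoint_first_light
    by (intro emeasure_UN_countable[symmetric]) (auto simp: sets_circle_lebesgue)
  also have "\<dots> \<le> ennreal (2 * pi)"
    using emeasure_space[of circle_lebesgue] by (simp add: emeasure_circle_lebesgue_space)
  finally have "emeasure \<mu> (unit_circle - heavy_set \<mu> k) \<le> ennreal ((2 / 3) ^ k / (2 * pi)) * ennreal (2 * pi)"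
    by (simp add: mult_left_mono)
  also have "\<dots> = ennreal ((2 / 3) ^ k)" by (simp flip: ennreal_mult)
  finally show ?thesis .
qed

theorem corollary1p6:
  fixes \<mu> :: "complex measure"
  assumes "finite_measure \<mu>"
    and "sets \<mu> = sets circle_borel"
    and "mutually_singular \<mu> circle_lebesgue"
    and "deriv (singular_inner \<mu>) \<in> nevanlinna_class"
  shows "\<exists>\<E>. countable \<E> \<and> (\<forall>E \<in> \<E>. beurling_carleson E) \<and>
           unit_circle - \<Union>\<E> \<in> null_sets \<mu>"
proof -
  have \<mu>: "circle_measure \<mu>"
    using assms(1,2) by (intro circle_measure.intro circle_measure_axioms.intro)
  then interpret \<mu>: circle_measure \<mu> .
  obtain \<phi> where \<phi>: "\<phi> \<in> borel_measurable circle_lebesgue" "(\<integral>\<^sup>+\<xi>. \<phi> \<xi> \<partial>circle_lebesgue) < \<infinity>"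
    "AE \<xi> in circle_lebesgue. \<forall>Q d. Q \<in> sets \<mu> \<longrightarrow> 0 < d \<longrightarrow> (\<forall>\<zeta>\<in>Q. dist \<zeta> \<xi> \<le> d) \<longrightarrow>
        ennreal (log_plus (2 * (measure \<mu> Q / d\<^sup>2))) \<le> \<phi> \<xi>"
    using singular_inner_deriv_nevanlinna_boundary[OF \<mu> assms(3,4)] by blast
  have bc: "beurling_carleson (heavy_set \<mu> k)" for k
    by (rule beurling_carleson_heavy_set[OF \<mu> \<phi>])
  then have "heavy_set \<mu> k \<in> null_sets circle_lebesgue" for k
    by (simp add: beurling_carleson_def)
  then have heavy_sets: "heavy_set \<mu> k \<in> sets \<mu>" for k
    using null_setsD2 by (metis \<mu>.sets_circle sets_circle_lebesgue)
  then have s: "unit_circle - \<Union>(range (heavy_set \<mu>)) \<in> sets \<mu>"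
    using sets.top[of \<mu>] by (auto simp: \<mu>.space_circle)
  have "measure \<mu> (unit_circle - \<Union>(range (heavy_set \<mu>))) \<le> (2 / 3) ^ k" for k
  proof -
    have "unit_circle - heavy_set \<mu> k \<in> sets \<mu>"
      using heavy_sets sets.top[of \<mu>] by (auto simp: \<mu>.space_circle)
    then have "measure \<mu> (unit_circle - \<Union>(range (heavy_set \<mu>))) \<le> measure \<mu> (unit_circle - heavy_set \<mu> k)"
      by (intro \<mu>.finite_measure_mono) auto
    also have "\<dots> \<le> (2 / 3) ^ k"
      using measure_complement_heavy_set[OF \<mu>, of k] by (simp add: \<mu>.emeasure_eq_measure)
    finally show ?thesis .
  qed
  moreover have "(\<lambda>k. (2 / 3 :: real) ^ k) \<longlonglongrightarrow> 0" by (rule LIMSEQ_realpow_zero) auto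
  ultimately have "measure \<mu> (unit_circle - \<Union>(range (heavy_set \<mu>))) \<le> 0"
    by (intro LIMSEQ_le_const[of _ 0]) auto
  then have "unit_circle - \<Union>(range (heavy_set \<mu>)) \<in> null_sets \<mu>"
    using s by (auto simp: null_sets_def \<mu>.emeasure_eq_measure measure_le_0_iff)
  then show ?thesis using bc by (intro exI[of _ "range (heavy_set \<mu>)"]) auto
qed

end
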